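(* Let $k$ be a field, let $\mathsf{E}$ be a left strictly locally finite $k$-linear category, and let $P$ be a locally finite left $\mathsf{E}$-module (i.e. $\dim_k P(x)<\infty$ for every object $x$). Then $P$ is isomorphic to $\Theta_\mathsf{E}(\mathfrak{P})$ for some (locally finite) left $\mathcal{C}_\mathsf{E}$-contramodule $\mathfrak{P}$ if and only if, for every object $y\in\mathsf{E}$, the set of all objects $x\in\mathsf{E}$ for which the action map $\operatorname{Hom}_\mathsf{E}(x,y)\otimes_k P(x)\to P(y)$ is nonzero is finite.
   Context: A small $k$-linear category $\mathsf{E}$ has $k$-vector spaces $\operatorname{Hom}_\mathsf{E}(x,y)$, $k$-bilinear associative composition and identities; it is assumed throughout that $\mathrm{id}_x\neq 0$ for every object $x$. A left $\mathsf{E}$-module is a $k$-linear functor $P:\mathsf{E}\to k\text{-Vect}$, given by spaces $P(x)$ and action maps $\operatorname{Hom}_\mathsf{E}(x,y)\otimes_k P(x)\to P(y)$. Write $x\preceq y$ if there are $n\ge1$ and objects $x=z_0,z_1,\dots,z_n=y$ with $\operatorname{Hom}_\mathsf{E}(z_{i-1},z_i)\ne0$ for all $i$; write $x\prec y$ if $x\preceq y$ and not $y\preceq x$. $\mathsf{E}$ is locally finite if every $\operatorname{Hom}_\mathsf{E}(x,y)$ is finite-dimensional and for all $x,y$ the set $\{z: x\preceq z\preceq y\}$ is finite. $\mathsf{E}$ is left strictly locally finite if it is locally finite and for every object $y$ there is a finite set of objects $X_y$ with $x\prec y$ for all $x\in X_y$ such that every morphism $f:z\to y$ with $z\prec y$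 can be written as $f=\sum_{i=1}^n h_ig_i$ ($n\ge0$) with $g_i:z\to x_i$, $h_i:x_i\to y$, $x_i\in X_y$. The coalgebra $\mathcal{C}_\mathsf{E}$: as a vector space $\mathcal{C}_\mathsf{E}=\bigoplus_{x,y}\mathcal{C}^{x,y}$ with $\mathcal{C}^{x,y}=\operatorname{Hom}_\mathsf{E}(x,y)^*$; the counit vanishes on $\mathcal{C}^{x,y}$ for $x\ne y$ and is evaluation at $\mathrm{id}_x$ on $\mathcal{C}^{x,x}$; the comultiplication maps $\mathcal{C}^{x,y}$ to $\bigoplus_{z}\mathcal{C}^{x,z}\otimes_k\mathcal{C}^{z,y}$ (finite sum over $x\preceq z\preceq y$), with components dual to the composition maps $\operatorname{Hom}_\mathsf{E}(x,z)\otimes\operatorname{Hom}_\mathsf{E}(z,y)\to\operatorname{Hom}_\mathsf{E}(x,y)$, $g\otimes h\mapsto hg$. A left contramodule over a coalgebra $(\mathcal{C},\mu,\epsilon)$ is a vector space $\mathfrak{P}$ with a linear map $\pi:\operatorname{Hom}_k(\mathcal{C},\mathfrak{P})\to\mathfrak{P}$ such that $\pi(c\mapsto\epsilon(c)p)=p$ and, identifying $\operatorname{Hom}_k(\mathcal{C},\operatorname{Hom}_k(\mathcal{C},\mathfrak{P}))\cong\operatorname{Hom}_k(\mathcal{C}\otimes_k\mathcal{C},\mathfrak{P})$ via $f\mapsto(c'\otimes c''\mapsto f(c'')(c'))$, the two maps $f\mapsto\pi(c\mapsto\pi(f(c)))$ and $f\mapsto\pi(f\circ\mu)$ coincide; morphisms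 are linear maps commuting with $\pi$. For $\varphi\in\mathcal{C}^*$ put $\varphi\cdot p=\pi(c\mapsto\varphi(c)p)$. The functor $\Theta_\mathsf{E}$ from left $\mathcal{C}_\mathsf{E}$-contramodules to left $\mathsf{E}$-modules: let $e_x\in\mathcal{C}_\mathsf{E}^*$ be evaluation at $\mathrm{id}_x$ on $\mathcal{C}^{x,x}$ and zero on other summands, and for $f\in\operatorname{Hom}_\mathsf{E}(x,y)$ let $\mathrm{ev}_f\in\mathcal{C}_\mathsf{E}^*$ be evaluation at $f$ on $\mathcal{C}^{x,y}$ and zero on other summands. Then $\Theta_\mathsf{E}(\mathfrak{P})(x)=e_x\cdot\mathfrak{P}$ (one has $\mathfrak{P}\cong\prod_x e_x\cdot\mathfrak{P}$), and $f\in\operatorname{Hom}_\mathsf{E}(x,y)$ acts by $p\mapsto\mathrm{ev}_f\cdot p\in e_y\cdot\mathfrak{P}$; on morphisms $\Theta_\mathsf{E}$ takes restrictions. A contramodule $\mathfrak{P}$ is locally finite if $\Theta_\mathsf{E}(\mathfrak{P})$ is locally finite. *)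

theory Defs
  imports Complex_Main "HOL-Library.Function_Algebras"
begin

(* Conventions.  The ground field k is a type 'k :: field.  Every k-vector space
   is represented as a subset (subspace) of an ambient type 'v :: ab_group_add
   carrying a scalar multiplication s :: 'k => 'v => 'v with vector_space s.
   Morphisms of E live in an ambient type 'm (scalar mult. sM); Hom x y is a
   subspace of it; cmp x y z h g is the composite  h o g  of g : x -> y, h : y -> z. *)

definition lin_on :: "('k \<Rightarrow> 'a \<Rightarrow> 'a) \<Rightarrow> ('k \<Rightarrow> 'b \<Rightarrow> 'b) \<Rightarrow> 'a::ab_group_add set
   \<Rightarrow> 'b::ab_group_add set \<Rightarrow> ('a \<Rightarrow> 'b) \<Rightarrow> bool" where
  "lin_on s1 s2 A B f \<longleftrightarrow> (\<forall>a\<in>A. f a \<in> B) \<and> (\<forall>a\<in>A. \<forall>b\<in>A. f (a + b) = f a + f b)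
     \<and> (\<forall>c. \<forall>a\<in>A. f (s1 c a) = s2 c (f a))"

definition fin_dim :: "('k::field \<Rightarrow> 'v::ab_group_add \<Rightarrow> 'v) \<Rightarrow> 'v set \<Rightarrow> bool" where
  "fin_dim s V \<longleftrightarrow> (\<exists>B. finite B \<and> B \<subseteq> V \<and> module.span s B = V)"

definition k_linear_category ::
  "('k::field \<Rightarrow> 'm::ab_group_add \<Rightarrow> 'm) \<Rightarrow> ('o \<Rightarrow> 'o \<Rightarrow> 'm set)
   \<Rightarrow> ('o \<Rightarrow> 'o \<Rightarrow> 'o \<Rightarrow> 'm \<Rightarrow> 'm \<Rightarrow> 'm) \<Rightarrow> ('o \<Rightarrow> 'm) \<Rightarrow> bool" where
  "k_linear_category sM Hom cmp ident \<longleftrightarrow>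
     vector_space sM \<and> (\<forall>x y. module.subspace sM (Hom x y))
   \<and> (\<forall>x y z. \<forall>h\<in>Hom y z. lin_on sM sM (Hom x y) (Hom x z) (cmp x y z h))
   \<and> (\<forall>x y z. \<forall>g\<in>Hom x y. lin_on sM sM (Hom y z) (Hom x z) (\<lambda>h. cmp x y z h g))
   \<and> (\<forall>w x y z f g h. f \<in> Hom w x \<longrightarrow> g \<in> Hom x y \<longrightarrow> h \<in> Hom y z \<longrightarrow>
          cmp w y z h (cmp w x y g f) = cmp w x z (cmp x y z h g) f)
   \<and> (\<forall>x. ident x \<in> Hom x x \<and> ident x \<noteq> 0)
   \<and> (\<forall>x y. \<forall>f\<in>Hom x y. cmp x y y (ident y) f = f \<and> cmp x x y f (ident x) = f)"

definition reach :: "('o \<Rightarrow> 'o \<Rightarrow> 'm::zero set) \<Rightarrow> 'o \<Rightarrow> 'o \<Rightarrow> bool" where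
  "reach Hom = tranclp (\<lambda>a b. \<exists>f\<in>Hom a b. f \<noteq> 0)"

definition sprec :: "('o \<Rightarrow> 'o \<Rightarrow> 'm::zero set) \<Rightarrow> 'o \<Rightarrow> 'o \<Rightarrow> bool" where
  "sprec Hom x y \<longleftrightarrow> reach Hom x y \<and> \<not> reach Hom y x"

definition locally_finite_cat ::
  "('k::field \<Rightarrow> 'm::ab_group_add \<Rightarrow> 'm) \<Rightarrow> ('o \<Rightarrow> 'o \<Rightarrow> 'm set) \<Rightarrow> bool" where
  "locally_finite_cat sM Hom \<longleftrightarrow>
     (\<forall>x y. fin_dim sM (Hom x y)) \<and> (\<forall>x y. finite {z. reach Hom x z \<and> reach Hom z y})"

definition left_strictly_locally_finite ::
  "('k::field \<Rightarrow> 'm::ab_group_add \<Rightarrow> 'm) \<Rightarrow> ('o \<Rightarrow> 'o \<Rightarrow> 'm set)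
   \<Rightarrow> ('o \<Rightarrow> 'o \<Rightarrow> 'o \<Rightarrow> 'm \<Rightarrow> 'm \<Rightarrow> 'm) \<Rightarrow> bool" where
  "left_strictly_locally_finite sM Hom cmp \<longleftrightarrow> locally_finite_cat sM Hom \<and>
     (\<forall>y. \<exists>X. finite X \<and> (\<forall>x\<in>X. sprec Hom x y) \<and>
        (\<forall>z f. sprec Hom z y \<longrightarrow> f \<in> Hom z y \<longrightarrow>
           (\<exists>(n::nat) xs g h. (\<forall>i<n. xs i \<in> X \<and> g i \<in> Hom z (xs i) \<and> h i \<in> Hom (xs i) y)
                \<and> f = (\<Sum>i<n. cmp z (xs i) y (h i) (g i)))))"

definition left_module ::
  "('k::field \<Rightarrow> 'm::ab_group_add \<Rightarrow> 'm) \<Rightarrow> ('o \<Rightarrow> 'o \<Rightarrow> 'm set)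
   \<Rightarrow> ('o \<Rightarrow> 'o \<Rightarrow> 'o \<Rightarrow> 'm \<Rightarrow> 'm \<Rightarrow> 'm) \<Rightarrow> ('o \<Rightarrow> 'm)
   \<Rightarrow> ('k \<Rightarrow> 'v::ab_group_add \<Rightarrow> 'v) \<Rightarrow> ('o \<Rightarrow> 'v set) \<Rightarrow> ('o \<Rightarrow> 'o \<Rightarrow> 'm \<Rightarrow> 'v \<Rightarrow> 'v) \<Rightarrow> bool" where
  "left_module sM Hom cmp ident sV P act \<longleftrightarrow>
     vector_space sV \<and> (\<forall>x. module.subspace sV (P x))
   \<and> (\<forall>x y. \<forall>f\<in>Hom x y. lin_on sV sV (P x) (P y) (act x y f))
   \<and> (\<forall>x y. \<forall>v\<in>P x. lin_on sM sV (Hom x y) (P y) (\<lambda>f. act x y f v))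
   \<and> (\<forall>x. \<forall>v\<in>P x. act x x (ident x) v = v)
   \<and> (\<forall>x y z g h v. g \<in> Hom x y \<longrightarrow> h \<in> Hom y z \<longrightarrow> v \<in> P x \<longrightarrow>
          act x z (cmp x y z h g) v = act y z h (act x y g v))"

definition locally_finite_module ::
  "('k::field \<Rightarrow> 'v::ab_group_add \<Rightarrow> 'v) \<Rightarrow> ('o \<Rightarrow> 'v set) \<Rightarrow> bool" where
  "locally_finite_module sV P \<longleftrightarrow> (\<forall>x. fin_dim sV (P x))"

definition module_iso ::
  "('o \<Rightarrow> 'o \<Rightarrow> 'm set) \<Rightarrow> ('k \<Rightarrow> 'v::ab_group_add \<Rightarrow> 'v) \<Rightarrow> ('o \<Rightarrow> 'v set) \<Rightarrow> ('o \<Rightarrow> 'o \<Rightarrow> 'm \<Rightarrow> 'v \<Rightarrow> 'v)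
   \<Rightarrow> ('k \<Rightarrow> 'w::ab_group_add \<Rightarrow> 'w) \<Rightarrow> ('o \<Rightarrow> 'w set) \<Rightarrow> ('o \<Rightarrow> 'o \<Rightarrow> 'm \<Rightarrow> 'w \<Rightarrow> 'w) \<Rightarrow> bool" where
  "module_iso Hom sV P actP sW Q actQ \<longleftrightarrow>
     (\<exists>\<theta>. (\<forall>x. lin_on sV sW (P x) (Q x) (\<theta> x) \<and> bij_betw (\<theta> x) (P x) (Q x))
        \<and> (\<forall>x y. \<forall>f\<in>Hom x y. \<forall>v\<in>P x. \<theta> y (actP x y f v) = actQ x y f (\<theta> x v)))"

(* An element c of C_E = \<Oplus> Hom(x,y)^* is a finitely supported family; c x y is a
   linear functional on Hom x y, extended by 0 outside Hom x y. *)
definition coalg :: "('k::field \<Rightarrow> 'm::ab_group_add \<Rightarrow> 'm) \<Rightarrow> ('o \<Rightarrow> 'o \<Rightarrow> 'm set)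
   \<Rightarrow> ('o \<Rightarrow> 'o \<Rightarrow> 'm \<Rightarrow> 'k) set" where
  "coalg sM Hom = {c. finite {(x, y). c x y \<noteq> (\<lambda>_. 0)}
      \<and> (\<forall>x y. lin_on sM (*) (Hom x y) UNIV (c x y) \<and> (\<forall>m. m \<notin> Hom x y \<longrightarrow> c x y m = 0))}"

definition cscale :: "'k::field \<Rightarrow> ('o \<Rightarrow> 'o \<Rightarrow> 'm \<Rightarrow> 'k) \<Rightarrow> ('o \<Rightarrow> 'o \<Rightarrow> 'm \<Rightarrow> 'k)" where
  "cscale a c = (\<lambda>x y m. a * c x y m)"

definition counit :: "('o \<Rightarrow> 'm) \<Rightarrow> ('o \<Rightarrow> 'o \<Rightarrow> 'm \<Rightarrow> 'k::field) \<Rightarrow> 'k" where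
  "counit ident c = (\<Sum>x\<in>{x. c x x (ident x) \<noteq> 0}. c x x (ident x))"

definition hbasis :: "('k::field \<Rightarrow> 'm::ab_group_add \<Rightarrow> 'm) \<Rightarrow> ('o \<Rightarrow> 'o \<Rightarrow> 'm set) \<Rightarrow> 'o \<Rightarrow> 'o \<Rightarrow> 'm set" where
  "hbasis sM Hom x y = (SOME B. finite B \<and> B \<subseteq> Hom x y \<and> \<not> module.dependent sM B
                              \<and> module.span sM B = Hom x y)"

definition dcoord :: "('k::field \<Rightarrow> 'm::ab_group_add \<Rightarrow> 'm) \<Rightarrow> ('o \<Rightarrow> 'o \<Rightarrow> 'm set) \<Rightarrow> 'o \<Rightarrow> 'o \<Rightarrow> 'm \<Rightarrow> 'm \<Rightarrow> 'k" where
  "dcoord sM Hom x y g = (\<lambda>m. if m \<in> Hom x y then module.representation sM (hbasis sM Hom x y) m g else 0)"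

definition csingle :: "'o \<Rightarrow> 'o \<Rightarrow> ('m \<Rightarrow> 'k::zero) \<Rightarrow> ('o \<Rightarrow> 'o \<Rightarrow> 'm \<Rightarrow> 'k)" where
  "csingle x y \<phi> = (\<lambda>x' y'. if x' = x \<and> y' = y then \<phi> else (\<lambda>_. 0))"

(* For a bilinear map b : C \<times> C \<rightarrow> V (= linear map C \<otimes> C \<rightarrow> V, b c' c'' = value on c' \<otimes> c''),
   bmu b c is the value of that linear map on the comultiplication \<mu>(c), where
   \<mu>(c)_{(x,z),(z,y)} = \<Sum>_{g,h} c(h g) g^* \<otimes> h^* over dual bases. *)
definition bmu :: "('k::field \<Rightarrow> 'm::ab_group_add \<Rightarrow> 'm) \<Rightarrow> ('o \<Rightarrow> 'o \<Rightarrow> 'm set)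
   \<Rightarrow> ('o \<Rightarrow> 'o \<Rightarrow> 'o \<Rightarrow> 'm \<Rightarrow> 'm \<Rightarrow> 'm) \<Rightarrow> ('k \<Rightarrow> 'p::ab_group_add \<Rightarrow> 'p)
   \<Rightarrow> (('o \<Rightarrow> 'o \<Rightarrow> 'm \<Rightarrow> 'k) \<Rightarrow> ('o \<Rightarrow> 'o \<Rightarrow> 'm \<Rightarrow> 'k) \<Rightarrow> 'p)
   \<Rightarrow> ('o \<Rightarrow> 'o \<Rightarrow> 'm \<Rightarrow> 'k) \<Rightarrow> 'p" where
  "bmu sM Hom cmp sP b c =
     (\<Sum>(x, y)\<in>{(x, y). c x y \<noteq> (\<lambda>_. 0)}.
        \<Sum>z\<in>{z. reach Hom x z \<and> reach Hom z y}.
          \<Sum>g\<in>hbasis sM Hom x z. \<Sum>h\<in>hbasis sM Hom z y.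
            sP (c x y (cmp x z y h g))
               (b (csingle x z (dcoord sM Hom x z g)) (csingle z y (dcoord sM Hom z y h))))"

(* extension by zero outside C_E, so that Hom_k(C_E, V) is a set of functions *)
definition cext :: "('o \<Rightarrow> 'o \<Rightarrow> 'm \<Rightarrow> 'k) set \<Rightarrow> (('o \<Rightarrow> 'o \<Rightarrow> 'm \<Rightarrow> 'k) \<Rightarrow> 'p::zero)
   \<Rightarrow> ('o \<Rightarrow> 'o \<Rightarrow> 'm \<Rightarrow> 'k) \<Rightarrow> 'p" where
  "cext C F = (\<lambda>c. if c \<in> C then F c else 0)"

definition homC :: "('k::field \<Rightarrow> 'm::ab_group_add \<Rightarrow> 'm) \<Rightarrow> ('o \<Rightarrow> 'o \<Rightarrow> 'm set)
   \<Rightarrow> ('k \<Rightarrow> 'p::ab_group_add \<Rightarrow> 'p) \<Rightarrow> 'p set \<Rightarrow> (('o \<Rightarrow> 'o \<Rightarrow> 'm \<Rightarrow> 'k) \<Rightarrow> 'p) set" where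
  "homC sM Hom sP Q = {F. lin_on cscale sP (coalg sM Hom) Q F \<and> (\<forall>c. c \<notin> coalg sM Hom \<longrightarrow> F c = 0)}"

definition fscale :: "('k \<Rightarrow> 'p \<Rightarrow> 'p) \<Rightarrow> 'k \<Rightarrow> ('c \<Rightarrow> 'p) \<Rightarrow> ('c \<Rightarrow> 'p)" where
  "fscale sP a F = (\<lambda>c. sP a (F c))"

definition contramodule ::
  "('k::field \<Rightarrow> 'm::ab_group_add \<Rightarrow> 'm) \<Rightarrow> ('o \<Rightarrow> 'o \<Rightarrow> 'm set)
   \<Rightarrow> ('o \<Rightarrow> 'o \<Rightarrow> 'o \<Rightarrow> 'm \<Rightarrow> 'm \<Rightarrow> 'm) \<Rightarrow> ('o \<Rightarrow> 'm)
   \<Rightarrow> ('k \<Rightarrow> 'p::ab_group_add \<Rightarrow> 'p) \<Rightarrow> 'p set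
   \<Rightarrow> ((('o \<Rightarrow> 'o \<Rightarrow> 'm \<Rightarrow> 'k) \<Rightarrow> 'p) \<Rightarrow> 'p) \<Rightarrow> bool" where
  "contramodule sM Hom cmp ident sP Q \<pi> \<longleftrightarrow>
     vector_space sP \<and> module.subspace sP Q
   \<and> lin_on (fscale sP) sP (homC sM Hom sP Q) Q \<pi>
   \<and> (\<forall>p\<in>Q. \<pi> (cext (coalg sM Hom) (\<lambda>c. sP (counit ident c) p)) = p)
   \<and> (\<forall>b. (\<forall>c''\<in>coalg sM Hom. lin_on cscale sP (coalg sM Hom) Q (\<lambda>c'. b c' c''))
          \<and> (\<forall>c'\<in>coalg sM Hom. lin_on cscale sP (coalg sM Hom) Q (b c')) \<longrightarrow>
        \<pi> (cext (coalg sM Hom) (\<lambda>c''. \<pi> (cext (coalg sM Hom) (\<lambda>c'. b c' c''))))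
        = \<pi> (cext (coalg sM Hom) (bmu sM Hom cmp sP b)))"

definition cdot :: "('k::field \<Rightarrow> 'm::ab_group_add \<Rightarrow> 'm) \<Rightarrow> ('o \<Rightarrow> 'o \<Rightarrow> 'm set)
   \<Rightarrow> ('k \<Rightarrow> 'p::ab_group_add \<Rightarrow> 'p) \<Rightarrow> ((('o \<Rightarrow> 'o \<Rightarrow> 'm \<Rightarrow> 'k) \<Rightarrow> 'p) \<Rightarrow> 'p)
   \<Rightarrow> (('o \<Rightarrow> 'o \<Rightarrow> 'm \<Rightarrow> 'k) \<Rightarrow> 'k) \<Rightarrow> 'p \<Rightarrow> 'p" where
  "cdot sM Hom sP \<pi> \<phi> p = \<pi> (cext (coalg sM Hom) (\<lambda>c. sP (\<phi> c) p))"

definition theta_obj :: "('k::field \<Rightarrow> 'm::ab_group_add \<Rightarrow> 'm) \<Rightarrow> ('o \<Rightarrow> 'o \<Rightarrow> 'm set) \<Rightarrow> ('o \<Rightarrow> 'm)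
   \<Rightarrow> ('k \<Rightarrow> 'p::ab_group_add \<Rightarrow> 'p) \<Rightarrow> 'p set \<Rightarrow> ((('o \<Rightarrow> 'o \<Rightarrow> 'm \<Rightarrow> 'k) \<Rightarrow> 'p) \<Rightarrow> 'p) \<Rightarrow> 'o \<Rightarrow> 'p set" where
  "theta_obj sM Hom ident sP Q \<pi> x = (\<lambda>p. cdot sM Hom sP \<pi> (\<lambda>c. c x x (ident x)) p) ` Q"

definition theta_act :: "('k::field \<Rightarrow> 'm::ab_group_add \<Rightarrow> 'm) \<Rightarrow> ('o \<Rightarrow> 'o \<Rightarrow> 'm set)
   \<Rightarrow> ('k \<Rightarrow> 'p::ab_group_add \<Rightarrow> 'p) \<Rightarrow> ((('o \<Rightarrow> 'o \<Rightarrow> 'm \<Rightarrow> 'k) \<Rightarrow> 'p) \<Rightarrow> 'p)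
   \<Rightarrow> 'o \<Rightarrow> 'o \<Rightarrow> 'm \<Rightarrow> 'p \<Rightarrow> 'p" where
  "theta_act sM Hom sP \<pi> x y f p = cdot sM Hom sP \<pi> (\<lambda>c. c x y f) p"

definition pscale :: "('k \<Rightarrow> 'v \<Rightarrow> 'v) \<Rightarrow> 'k \<Rightarrow> ('o \<Rightarrow> 'v) \<Rightarrow> ('o \<Rightarrow> 'v)" where
  "pscale sV a f = (\<lambda>x. sV a (f x))"

end

theory Submission
  imports Defs
begin


text \<open>
  Let \<open>L(y)\<close> be the intersection, over all finite sets \<open>T\<close> of objects, of the subspaces of \<open>P(y)\<close>
  spanned by the images of the actions of morphisms \<open>z \<rightarrow> y\<close> with \<open>z \<notin> T\<close>. As \<open>P(y)\<close> is
  finite-dimensional, the intersection is attained at some \<open>T\<close>; in particular \<open>L(y) = 0\<close> implies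
  the finiteness condition at \<open>y\<close>. Taking \<open>T\<close> large and factoring \<open>z \<rightarrow> y\<close> through \<open>X\<^sub>y\<close> shows that
  every \<open>p \<in> L(y)\<close> is a sum \<open>\<Sum> h\<^sub>i p\<^sub>i\<close> with \<open>h\<^sub>i : x\<^sub>i \<rightarrow> y\<close>, \<open>x\<^sub>i \<in> X\<^sub>y\<close>, \<open>p\<^sub>i \<in> L(x\<^sub>i)\<close>. Iterating this
  gives an infinite sum of all the unfoldings, which has finitely many terms over each object
  because the intervals of the preorder are finite. If \<open>P\<close> comes from a contramodule, this infinite
  sum can be evaluated, and contraassociativity says that its value does not change when its first
  term, of value \<open>p\<close>, is dropped. Hence \<open>p = 0\<close>, as in the contramodule Nakayama lemma.
  Conversely, the finiteness condition makes
  \<open>\<pi>(F)(y) = \<Sum>\<^sub>x \<Sum>\<^sub>g g \<cdot> F(g\<^sup>*)(x)\<close> a finite sum, which defines a contramodule structure on the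
  product of all \<open>P(x)\<close>.
\<close>

section \<open>Linear algebra on subspaces\<close>

lemma lin_on_mem: "lin_on s1 s2 A B f \<Longrightarrow> a \<in> A \<Longrightarrow> f a \<in> B"
  and lin_on_add: "lin_on s1 s2 A B f \<Longrightarrow> a \<in> A \<Longrightarrow> b \<in> A \<Longrightarrow> f (a + b) = f a + f b"
  and lin_on_scale: "lin_on s1 s2 A B f \<Longrightarrow> a \<in> A \<Longrightarrow> f (s1 c a) = s2 c (f a)"
  by (auto simp: lin_on_def)

lemma lin_on_zero:
  assumes "lin_on s1 s2 A B f" "0 \<in> A"
  shows "f 0 = 0"
  using lin_on_add[OF assms(1,2,2)] by simp

lemma (in module) lin_on_sum:
  assumes "lin_on scale s2 A B f" "subspace A" "\<And>i. i \<in> I \<Longrightarrow> v i \<in> A"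
  shows "f (\<Sum>i\<in>I. v i) = (\<Sum>i\<in>I. f (v i))"
  using assms(3)
proof (induction I rule: infinite_finite_induct)
  case (insert i I)
  have "f (v i + sum v I) = f (v i) + f (sum v I)"
    by (rule lin_on_add[OF assms(1)]) (use insert.prems assms(2) in \<open>auto intro: subspace_sum\<close>)
  then show ?case using insert by simp
qed (use lin_on_zero[OF assms(1) subspace_0[OF assms(2)]] in auto)

lemma (in module) lin_on_sum_scale:
  assumes "lin_on scale s2 A B f" "subspace A" "\<And>i. i \<in> I \<Longrightarrow> v i \<in> A"
  shows "f (\<Sum>i\<in>I. a i *s v i) = (\<Sum>i\<in>I. s2 (a i) (f (v i)))"
proof -
  have "f (\<Sum>i\<in>I. a i *s v i) = (\<Sum>i\<in>I. f (a i *s v i))"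
    by (rule lin_on_sum[OF assms(1,2)]) (use assms in \<open>auto intro: subspace_scale\<close>)
  then show ?thesis using lin_on_scale[OF assms(1) assms(3)] by simp
qed

lemma fin_dim_image:
  assumes "module s1" "module s2" "lin_on s1 s2 A A' f" "f ` A = A'"
    and "module.subspace s1 A" "module.subspace s2 A'" "fin_dim s1 A"
  shows "fin_dim s2 A'"
proof -
  interpret m1: module s1 by fact
  interpret m2: module s2 by fact
  obtain B where B: "finite B" "B \<subseteq> A" "m1.span B = A" using assms(7) by (auto simp: fin_dim_def)
  have "m2.span (f ` B) = A'"
  proof
    show "m2.span (f ` B) \<subseteq> A'" using B assms by (intro m2.span_minimal) auto
    show "A' \<subseteq> m2.span (f ` B)"
    proof
      fix w assume "w \<in> A'"
      then obtain v where v: "v \<in> m1.span B" "w = f v" using assms(4) B by auto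
      obtain a where a: "v = (\<Sum>b\<in>B. s1 (a b) b)" using v B m1.span_finite by auto
      have "w = (\<Sum>b\<in>B. s2 (a b) (f b))"
        unfolding v a by (rule m1.lin_on_sum_scale[OF assms(3,5)]) (use B in auto)
      then show "w \<in> m2.span (f ` B)"
        by (simp add: m2.span_sum m2.span_scale m2.span_base)
    qed
  qed
  then show ?thesis using B assms(4) unfolding fin_dim_def by blast
qed

text \<open>A vector of \<open>V\<close> outside \<open>U\<close> could be adjoined to a basis of
  \<open>U\<close>, giving an independent subset of \<open>V\<close> with more than
  \<open>dim V\<close> elements. The finite \<open>W\<close> makes all bases involved
  finite.\<close>

lemma (in vector_space) dim_eq_subset:
  assumes "V \<subseteq> span W" "finite W" "subspace V" "U \<subseteq> V" "subspace U" "dim V \<le> dim U"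
  shows "U = V"
proof -
  obtain B where B: "B \<subseteq> U" "independent B" "U \<subseteq> span B" "card B = dim U" using basis_exists by blast
  obtain C where C: "C \<subseteq> V" "independent C" "V \<subseteq> span C" "card C = dim V" using basis_exists by blast
  have fin: "finite B" "finite C"
    using independent_span_bound[OF assms(2), of B] independent_span_bound[OF assms(2), of C] B C assms
    by (meson subset_trans)+
  have "v \<in> U" if "v \<in> V" for v
  proof (rule ccontr)
    assume "v \<notin> U"
    then have v: "v \<notin> span B" using span_minimal[OF B(1) assms(5)] by auto
    then have "independent (insert v B)" using B independent_insertI by auto
    moreover have "insert v B \<subseteq> span C" using that B C assms by auto
    ultimately have "card (insert v B) \<le> card C" using independent_span_bound[OF fin(2)] by blast
    moreover have "v \<notin> B" using v span_base by auto
    ultimately show False using fin B C assms by simp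
  qed
  then show ?thesis using assms by auto
qed


section \<open>The coalgebra of a locally finite category\<close>

locale lf_category = M: vector_space sM
  for sM :: "'k::field \<Rightarrow> 'm::ab_group_add \<Rightarrow> 'm" +
  fixes Hom :: "'o \<Rightarrow> 'o \<Rightarrow> 'm set"
    and cmp :: "'o \<Rightarrow> 'o \<Rightarrow> 'o \<Rightarrow> 'm \<Rightarrow> 'm \<Rightarrow> 'm"
    and ident :: "'o \<Rightarrow> 'm"
  assumes cat: "k_linear_category sM Hom cmp ident"
    and lf: "locally_finite_cat sM Hom"
begin

abbreviation "B \<equiv> hbasis sM Hom"
abbreviation "coord \<equiv> dcoord sM Hom"
abbreviation "C \<equiv> coalg sM Hom"
abbreviation "R \<equiv> reach Hom"
abbreviation "dual x y g \<equiv> csingle x y (coord x y g)"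

lemma sub_Hom: "M.subspace (Hom x y)"
  using cat by (auto simp: k_linear_category_def)

text \<open>Local finiteness gives a finite spanning set of \<open>Hom x y\<close>; a maximal
  independent subset of it witnesses the choice in \<open>hbasis\<close>.\<close>

lemma hbasis:
  shows fin_B: "finite (B x y)" and B_sub: "B x y \<subseteq> Hom x y"
    and ind_B: "M.independent (B x y)" and span_B: "M.span (B x y) = Hom x y"
proof -
  obtain A where A: "finite A" "A \<subseteq> Hom x y" "M.span A = Hom x y"
    using lf unfolding locally_finite_cat_def fin_dim_def by blast
  obtain D where D: "D \<subseteq> A" "M.independent D" "A \<subseteq> M.span D"
    using M.maximal_independent_subset[of A] by blast
  have "M.span D = Hom x y"
    using D A by (metis M.span_mono M.span_span subset_antisym)
  then have "\<exists>D. finite D \<and> D \<subseteq> Hom x y \<and> M.independent D \<and> M.span D = Hom x y"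
    using A(1,2) D finite_subset[OF D(1) A(1)] by (meson subset_trans)
  from someI_ex[OF this]
  show "finite (B x y)" "B x y \<subseteq> Hom x y" "M.independent (B x y)" "M.span (B x y) = Hom x y"
    unfolding hbasis_def by auto
qed

lemma B_Hom: "g \<in> B x y \<Longrightarrow> g \<in> Hom x y"
  using B_sub by auto

lemma coord_expand: "f \<in> Hom x y \<Longrightarrow> (\<Sum>g\<in>B x y. sM (coord x y g f) g) = f"
  unfolding dcoord_def using M.sum_representation_eq[OF ind_B _ fin_B order_refl, of f x y]
  by (simp add: span_B)

lemma coord_B: "g \<in> B x y \<Longrightarrow> f \<in> B x y \<Longrightarrow> coord x y g f = (if f = g then 1 else 0)"
  unfolding dcoord_def using M.representation_basis[OF ind_B, of f x y] B_Hom by auto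

lemma lin_coord: "lin_on sM (*) (Hom x y) UNIV (coord x y g)"
proof -
  have "a + b \<in> Hom x y" "sM c a \<in> Hom x y" if "a \<in> Hom x y" "b \<in> Hom x y" for a b c
    using that sub_Hom M.subspace_add M.subspace_scale by auto
  then show ?thesis
    unfolding lin_on_def dcoord_def
    using M.representation_add[OF ind_B, of _ x y] M.representation_scale[OF ind_B, of _ x y]
    by (auto simp: span_B)
qed

text \<open>Apply \<open>F\<close> to the basis expansion of \<open>f\<close>. Later this removes
  the chosen bases again: sums over a basis and its dual collapse to values at composite
  morphisms.\<close>

lemma lin_expand:
  assumes "lin_on sM s2 (Hom x y) V F" "f \<in> Hom x y"
  shows "(\<Sum>g\<in>B x y. s2 (coord x y g f) (F g)) = F f"
proof -
  have "F (\<Sum>g\<in>B x y. sM (coord x y g f) g) = (\<Sum>g\<in>B x y. s2 (coord x y g f) (F g))"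
    using assms(1) sub_Hom B_Hom by (rule M.lin_on_sum_scale)
  then show ?thesis using coord_expand assms by simp
qed

lemma coalg_lin: "c \<in> C \<Longrightarrow> lin_on sM (*) (Hom x y) UNIV (c x y)"
  by (auto simp: coalg_def)

lemma coalg_fin: "c \<in> C \<Longrightarrow> finite {x. c x y \<noteq> (\<lambda>_. 0)}"
proof -
  assume "c \<in> C"
  then have "finite {(x, y). c x y \<noteq> (\<lambda>_. 0)}" by (auto simp: coalg_def)
  moreover have "{x. c x y \<noteq> (\<lambda>_. 0)} \<subseteq> fst ` {(x, y). c x y \<noteq> (\<lambda>_. 0)}" by force
  ultimately show ?thesis using finite_surj by blast
qed

lemma csingle_coalg:
  assumes "lin_on sM (*) (Hom x y) UNIV \<phi>" "\<And>m. m \<notin> Hom x y \<Longrightarrow> \<phi> m = 0"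
  shows "csingle x y \<phi> \<in> C"
proof -
  have "{(x', y'). csingle x y \<phi> x' y' \<noteq> (\<lambda>_. 0)} \<subseteq> {(x, y)}" by (auto simp: csingle_def)
  then have "finite {(x', y'). csingle x y \<phi> x' y' \<noteq> (\<lambda>_. 0)}" using finite_subset by blast
  then show ?thesis using assms unfolding coalg_def by (auto simp: csingle_def lin_on_def)
qed

lemma dual_coalg: "dual x y g \<in> C"
  by (rule csingle_coalg[OF lin_coord]) (auto simp: dcoord_def)

lemma dual_apply: "dual x y g x' y' = (if x' = x \<and> y' = y then coord x y g else (\<lambda>_. 0))"
  by (simp add: csingle_def)

lemma coord_nonzero: "g \<in> B x y \<Longrightarrow> coord x y g \<noteq> (\<lambda>_. 0)"
  using coord_B[of g x y g] by (metis zero_neq_one)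

lemma coalg_add: "c \<in> C \<Longrightarrow> d \<in> C \<Longrightarrow> c + d \<in> C"
proof -
  assume cd: "c \<in> C" "d \<in> C"
  have "{(x, y). (c + d) x y \<noteq> (\<lambda>_. 0)} \<subseteq> {(x, y). c x y \<noteq> (\<lambda>_. 0)} \<union> {(x, y). d x y \<noteq> (\<lambda>_. 0)}"
    by (auto simp: fun_eq_iff)
  then have "finite {(x, y). (c + d) x y \<noteq> (\<lambda>_. 0)}"
    using cd by (auto simp: coalg_def intro: finite_subset)
  then show ?thesis using cd by (auto simp: coalg_def lin_on_def algebra_simps)
qed

lemma coalg_scale: "c \<in> C \<Longrightarrow> cscale a c \<in> C"
proof -
  assume c: "c \<in> C"
  have "{(x, y). cscale a c x y \<noteq> (\<lambda>_. 0)} \<subseteq> {(x, y). c x y \<noteq> (\<lambda>_. 0)}"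
    by (auto simp: fun_eq_iff cscale_def)
  then have "finite {(x, y). cscale a c x y \<noteq> (\<lambda>_. 0)}"
    using c by (auto simp: coalg_def intro: finite_subset)
  then show ?thesis using c by (auto simp: coalg_def lin_on_def cscale_def algebra_simps)
qed

lemma cmp_Hom: "g \<in> Hom x y \<Longrightarrow> h \<in> Hom y z \<Longrightarrow> cmp x y z h g \<in> Hom x z"
  using cat unfolding k_linear_category_def lin_on_def by blast

lemma ident_Hom: "ident x \<in> Hom x x" and ident_nz: "ident x \<noteq> 0"
  using cat unfolding k_linear_category_def by auto

lemma reach_refl: "R x x"
  unfolding reach_def using ident_Hom ident_nz by blast

lemma reach_trans: "R x y \<Longrightarrow> R y z \<Longrightarrow> R x z"
  unfolding reach_def by (rule tranclp_trans)

lemma reach_Hom: "f \<in> Hom x y \<Longrightarrow> f \<noteq> 0 \<Longrightarrow> R x y"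
  unfolding reach_def by blast

text \<open>Members of an independent set are nonzero. Hence \<open>B x z\<close> or
  \<open>B z y\<close> is empty unless \<open>z\<close> lies in the interval from \<open>x\<close>
  to \<open>y\<close>.\<close>

lemma reach_B: "g \<in> B x y \<Longrightarrow> R x y"
  using reach_Hom[OF B_Hom] ind_B[of x y] M.dependent_zero[of "B x y"] by blast

lemma fin_interval: "finite {z. R x z \<and> R z y}"
  using lf by (auto simp: locally_finite_cat_def)

lemma counit_dual: "counit ident (dual x y g) = (if x = y then coord x x g (ident x) else 0)"
proof (cases "x = y \<and> coord x x g (ident x) \<noteq> 0")
  case True
  then have "{z. dual x y g z z (ident z) \<noteq> 0} = {x}" by (auto simp: dual_apply)
  then show ?thesis using True by (simp add: counit_def dual_apply)
next
  case False
  then have "{z. dual x y g z z (ident z) \<noteq> 0} = {}" by (auto simp: dual_apply)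
  then show ?thesis using False unfolding counit_def by auto
qed

lemma bmu_dual:
  assumes "f \<in> B x y"
  shows "bmu sM Hom cmp sP b (dual x y f) =
    (\<Sum>z\<in>{z. R x z \<and> R z y}. \<Sum>g\<in>B x z. \<Sum>h\<in>B z y.
       sP (coord x y f (cmp x z y h g)) (b (dual x z g) (dual z y h)))"
proof -
  have "{(x', y'). dual x y f x' y' \<noteq> (\<lambda>_. 0)} = {(x, y)}"
    using coord_nonzero[OF assms] by (auto simp: dual_apply)
  then show ?thesis by (simp add: bmu_def dual_apply)
qed

end

section \<open>The part of a module that survives the removal of finitely many objects\<close>

locale slf_module = lf_category sM Hom cmp ident + V: vector_space sV
  for sM :: "'k::field \<Rightarrow> 'm::ab_group_add \<Rightarrow> 'm"
    and Hom :: "'o \<Rightarrow> 'o \<Rightarrow> 'm set"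
    and cmp :: "'o \<Rightarrow> 'o \<Rightarrow> 'o \<Rightarrow> 'm \<Rightarrow> 'm \<Rightarrow> 'm"
    and ident :: "'o \<Rightarrow> 'm"
    and sV :: "'k \<Rightarrow> 'v::ab_group_add \<Rightarrow> 'v" +
  fixes P :: "'o \<Rightarrow> 'v set"
    and act :: "'o \<Rightarrow> 'o \<Rightarrow> 'm \<Rightarrow> 'v \<Rightarrow> 'v"
  assumes slf: "left_strictly_locally_finite sM Hom cmp"
    and left_mod: "left_module sM Hom cmp ident sV P act"
    and fin_mod: "locally_finite_module sV P"
begin

lemma sub_P: "V.subspace (P x)"
  and act_lin: "f \<in> Hom x y \<Longrightarrow> lin_on sV sV (P x) (P y) (act x y f)"
  and act_lin_left: "v \<in> P x \<Longrightarrow> lin_on sM sV (Hom x y) (P y) (\<lambda>f. act x y f v)"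
  and act_ident: "v \<in> P x \<Longrightarrow> act x x (ident x) v = v"
  and act_cmp: "g \<in> Hom x y \<Longrightarrow> h \<in> Hom y z \<Longrightarrow> v \<in> P x \<Longrightarrow>
    act x z (cmp x y z h g) v = act y z h (act x y g v)"
  using left_mod by (auto simp: left_module_def)

lemmas act_mem = lin_on_mem[OF act_lin]

lemma zero_P: "0 \<in> P x"
  using sub_P V.subspace_0 by auto

lemma act_zero: "f \<in> Hom x y \<Longrightarrow> act x y f 0 = 0"
  using lin_on_zero[OF act_lin zero_P] by auto

lemma act_zero_left: "v \<in> P x \<Longrightarrow> act x y 0 v = 0"
  using lin_on_zero[OF act_lin_left M.subspace_0[OF sub_Hom]] by auto

definition restr :: "'o set \<Rightarrow> 'o \<Rightarrow> 'v set" where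
  "restr T y = V.span {act z y f v |z f v. z \<notin> T \<and> f \<in> Hom z y \<and> v \<in> P z}"

definition core :: "'o \<Rightarrow> 'v set" where
  "core y = (\<Inter>T\<in>{T. finite T}. restr T y)"

lemma restr_gen: "z \<notin> T \<Longrightarrow> f \<in> Hom z y \<Longrightarrow> v \<in> P z \<Longrightarrow> act z y f v \<in> restr T y"
  unfolding restr_def by (rule V.span_base) blast

lemma restr_antimono: "T \<subseteq> T' \<Longrightarrow> restr T' y \<subseteq> restr T y"
  unfolding restr_def by (rule V.span_mono) blast

lemma restr_sub_P: "restr T y \<subseteq> P y"
  unfolding restr_def by (rule V.span_minimal) (use act_mem sub_P in auto)

text \<open>Take \<open>T\<close> with \<open>restr T y\<close> of minimal dimension. For finite
  \<open>T'\<close>, the subspace \<open>restr (T \<union> T') y\<close> lies in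
  \<open>restr T y\<close> and has no smaller dimension, so the two agree and
  \<open>restr T y\<close> is contained in \<open>restr T' y\<close>.\<close>

lemma core_attained: "\<exists>T. finite T \<and> restr T y = core y"
proof -
  obtain A where A: "finite A" "V.span A = P y"
    using fin_mod unfolding locally_finite_module_def fin_dim_def by blast
  have "\<exists>T. finite T \<and> (\<forall>T'. finite T' \<longrightarrow> V.dim (restr T y) \<le> V.dim (restr T' y))"
    using ex_has_least_nat[of finite "{}" "\<lambda>T. V.dim (restr T y)"] by auto
  then obtain T where T: "finite T" "\<And>T'. finite T' \<Longrightarrow> V.dim (restr T y) \<le> V.dim (restr T' y)"
    by blast
  have "restr T y \<subseteq> restr T' y" if "finite T'" for T'
  proof -
    have "restr (T \<union> T') y = restr T y"
    proof (rule V.dim_eq_subset[OF _ A(1)])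
      show "restr T y \<subseteq> V.span A" using A restr_sub_P by simp
      show "restr (T \<union> T') y \<subseteq> restr T y" by (rule restr_antimono) simp
      show "V.dim (restr T y) \<le> V.dim (restr (T \<union> T') y)" using T that by simp
    qed (simp_all add: restr_def)
    then show ?thesis using restr_antimono[of T' "T \<union> T'"] by auto
  qed
  then have "restr T y = core y" using T(1) unfolding core_def by blast
  then show ?thesis using T(1) by blast
qed

lemma sub_core: "V.subspace (core y)"
proof -
  obtain T where "restr T y = core y" using core_attained by blast
  moreover have "V.subspace (restr T y)" for T by (simp add: restr_def)
  ultimately show ?thesis by metis
qed

lemma core_sub_P: "core y \<subseteq> P y"
  using core_attained[of y] restr_sub_P[of _ y] by blast

text \<open>If \<open>T\<close> attains the core, a source outside \<open>T\<close> with nonzero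
  action on the way to \<open>y\<close> would put a nonzero vector into
  \<open>restr T y\<close>.\<close>

lemma core_eq_zero:
  assumes "core y = {0}"
  shows "finite {x. \<exists>f\<in>Hom x y. \<exists>v\<in>P x. act x y f v \<noteq> 0}"
proof -
  obtain T where T: "finite T" "restr T y = {0}" using core_attained[of y] assms by auto
  have "{x. \<exists>f\<in>Hom x y. \<exists>v\<in>P x. act x y f v \<noteq> 0} \<subseteq> T"
    using restr_gen[of _ T _ y] T(2) by blast
  then show ?thesis using T(1) finite_subset by blast
qed

section \<open>Decomposition of core vectors along strictly smaller objects\<close>

text \<open>The decomposable vectors form a subspace \<open>D\<close>, and the core lies in
  \<open>restr S y\<close> for every finite \<open>S\<close>. So it suffices to find one finite
  \<open>S\<close> such that \<open>D\<close> contains all generators of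
  \<open>restr S y\<close>.\<close>

lemma core_decomp:
  assumes X: "finite X"
    and gen: "\<And>z f. sprec Hom z y \<Longrightarrow> f \<in> Hom z y \<Longrightarrow>
      \<exists>(n::nat) xs g h. (\<forall>i<n. xs i \<in> X \<and> g i \<in> Hom z (xs i) \<and> h i \<in> Hom (xs i) y)
        \<and> f = (\<Sum>i<n. cmp z (xs i) y (h i) (g i))"
    and v: "v \<in> core y"
  shows "\<exists>u. (\<forall>x g. u x g \<in> core x) \<and> (\<forall>x g. x \<notin> X \<longrightarrow> u x g = 0)
     \<and> v = (\<Sum>x\<in>X. \<Sum>g\<in>B x y. act x y g (u x g))"
proof -
  define D where "D = {v. \<exists>u. (\<forall>x g. u x g \<in> core x) \<and> (\<forall>x g. x \<notin> X \<longrightarrow> u x g = 0)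
     \<and> v = (\<Sum>x\<in>X. \<Sum>g\<in>B x y. act x y g (u x g))}"
  have core_P: "w \<in> P x" if "w \<in> core x" for w x using that core_sub_P by auto
  have core0: "0 \<in> core x" for x using sub_core V.subspace_0 by auto
  have sub_D: "V.subspace D"
  proof (rule V.subspaceI)
    show "0 \<in> D"
      unfolding D_def using core0 act_zero B_Hom by (auto intro!: exI[of _ "\<lambda>_ _. 0"])
  next
    fix v w assume "v \<in> D" "w \<in> D"
    then obtain u u' where u: "\<And>x g. u x g \<in> core x" "\<And>x g. x \<notin> X \<Longrightarrow> u x g = 0"
        "v = (\<Sum>x\<in>X. \<Sum>g\<in>B x y. act x y g (u x g))"
      and u': "\<And>x g. u' x g \<in> core x" "\<And>x g. x \<notin> X \<Longrightarrow> u' x g = 0"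
        "w = (\<Sum>x\<in>X. \<Sum>g\<in>B x y. act x y g (u' x g))" unfolding D_def by blast
    have "v + w = (\<Sum>x\<in>X. \<Sum>g\<in>B x y. act x y g (u x g + u' x g))"
      unfolding u(3) u'(3) sum.distrib[symmetric]
      by (intro sum.cong refl) (simp add: lin_on_add[OF act_lin] B_Hom core_P u u')
    then show "v + w \<in> D" unfolding D_def mem_Collect_eq
      by (intro exI[of _ "\<lambda>x g. u x g + u' x g"]) (simp add: u u' V.subspace_add[OF sub_core])
  next
    fix a v assume "v \<in> D"
    then obtain u where u: "\<And>x g. u x g \<in> core x" "\<And>x g. x \<notin> X \<Longrightarrow> u x g = 0"
        "v = (\<Sum>x\<in>X. \<Sum>g\<in>B x y. act x y g (u x g))" unfolding D_def by blast
    have "sV a v = (\<Sum>x\<in>X. \<Sum>g\<in>B x y. act x y g (sV a (u x g)))"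
      unfolding u(3) V.scale_sum_right
      by (intro sum.cong refl) (simp add: lin_on_scale[OF act_lin] B_Hom core_P u)
    then show "sV a v \<in> D" unfolding D_def mem_Collect_eq
      by (intro exI[of _ "\<lambda>x g. sV a (u x g)"]) (simp add: u V.subspace_scale[OF sub_core])
  qed
  have elem: "act x y h w \<in> D" if "x \<in> X" "h \<in> Hom x y" "w \<in> core x" for x h w
  proof -
    \<comment> \<open>The coordinates of \<open>h\<close> in \<open>B x y\<close> are moved onto
      \<open>w\<close>, whose multiples stay in the core.\<close>
    define u where "u x' g = (if x' = x then sV (coord x y g h) w else 0)" for x' g
    have "act x y h w = (\<Sum>g\<in>B x y. sV (coord x y g h) (act x y g w))"
      using lin_expand[OF act_lin_left[OF core_P[OF that(3)]] that(2)] by simp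
    also have "\<dots> = (\<Sum>g\<in>B x y. act x y g (u x g))"
      unfolding u_def by (simp add: lin_on_scale[OF act_lin] B_Hom core_P that)
    also have "\<dots> = (\<Sum>x'\<in>X. if x' = x then \<Sum>g\<in>B x y. act x y g (u x g) else 0)"
      using X that by simp
    also have "\<dots> = (\<Sum>x'\<in>X. \<Sum>g\<in>B x' y. act x' y g (u x' g))"
      by (intro sum.cong refl) (auto simp: u_def act_zero B_Hom)
    finally show ?thesis unfolding D_def mem_Collect_eq
      by (intro exI[of _ u]) (use that sub_core core0 V.subspace_scale in \<open>auto simp: u_def\<close>)
  qed
  obtain T where T: "\<And>x. finite (T x)" "\<And>x. restr (T x) x = core x"
    using core_attained by metis
  \<comment> \<open>For a source \<open>z\<close> outside \<open>S\<close>: avoiding every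
    \<open>T x\<close> sends the images of \<open>P z\<close> in \<open>P x\<close>, for
    \<open>x \<in> X\<close>, into \<open>core x\<close>; avoiding the objects equivalent to
    \<open>y\<close> makes \<open>z\<close> strictly smaller than \<open>y\<close> whenever there is
    a nonzero morphism, so that \<open>gen\<close> applies.\<close>
  define S where "S = (\<Union>x\<in>X. T x) \<union> {z. R y z \<and> R z y}"
  have S: "finite S" using X T fin_interval by (auto simp: S_def)
  have "act z y f w \<in> D" if z: "z \<notin> S" and f: "f \<in> Hom z y" and w: "w \<in> P z" for z f w
  proof (cases "f = 0")
    case True
    then show ?thesis using act_zero_left[OF w] V.subspace_0[OF sub_D] by simp
  next
    case False
    then have "R z y" using reach_Hom f by blast
    then have "sprec Hom z y" using z by (auto simp: sprec_def S_def)
    from gen[OF this f] obtain n :: nat and xs g h where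
      *: "\<And>i. i < n \<Longrightarrow> xs i \<in> X" "\<And>i. i < n \<Longrightarrow> g i \<in> Hom z (xs i)"
        "\<And>i. i < n \<Longrightarrow> h i \<in> Hom (xs i) y"
        "f = (\<Sum>i<n. cmp z (xs i) y (h i) (g i))" by blast
    have "act z y f w = (\<Sum>i<n. act z y (cmp z (xs i) y (h i) (g i)) w)"
      unfolding *(4) by (rule M.lin_on_sum[OF act_lin_left[OF w] sub_Hom]) (auto intro: cmp_Hom *)
    also have "\<dots> = (\<Sum>i<n. act (xs i) y (h i) (act z (xs i) (g i) w))"
      by (intro sum.cong refl act_cmp) (auto intro: * w)
    also have "\<dots> \<in> D"
    proof (rule V.subspace_sum[OF sub_D])
      fix i assume "i \<in> {..<n}"
      then have i: "i < n" by simp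
      have "z \<notin> T (xs i)" using z *(1)[OF i] by (auto simp: S_def)
      then have "act z (xs i) (g i) w \<in> core (xs i)"
        using restr_gen[OF _ *(2)[OF i] w] T(2) by auto
      then show "act (xs i) y (h i) (act z (xs i) (g i) w) \<in> D"
        using elem *(1)[OF i] *(3)[OF i] by blast
    qed
    finally show ?thesis .
  qed
  then have "restr S y \<subseteq> D" unfolding restr_def by (intro V.span_minimal sub_D) blast
  moreover have "v \<in> restr S y" using v S by (auto simp: core_def)
  ultimately show ?thesis unfolding D_def by blast
qed

text \<open>The decompositions are chosen uniformly in \<open>z\<close> and \<open>v\<close>. The
  coefficients vanish outside \<open>X z\<close> even when \<open>v\<close> is not in the core; the
  recursion in \<open>unfolding_fixpoint\<close> relies on this, since it also meets arguments not
  known to lie there.\<close>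

lemma core_decomp_choice:
  obtains X u where "\<And>z. finite (X z)" "\<And>x z. x \<in> X z \<Longrightarrow> sprec Hom x z"
    "\<And>z v x g. v \<in> core z \<Longrightarrow> u z v x g \<in> core x"
    "\<And>z v x g. x \<notin> X z \<Longrightarrow> u z v x g = 0"
    "\<And>z v. v \<in> core z \<Longrightarrow> (\<Sum>x\<in>X z. \<Sum>g\<in>B x z. act x z g (u z v x g)) = v"
proof -
  define D where "D y X v u \<longleftrightarrow> (\<forall>x g. u x g \<in> core x) \<and> (\<forall>x g. x \<notin> X \<longrightarrow> u x g = 0)
     \<and> v = (\<Sum>x\<in>X. \<Sum>g\<in>B x y. act x y g (u x g))"
    for y X v and u :: "'o \<Rightarrow> 'm \<Rightarrow> 'v"
  define W where "W y X \<longleftrightarrow> finite X \<and> (\<forall>x\<in>X. sprec Hom x y) \<and> (\<forall>v\<in>core y. \<exists>u. D y X v u)" for y X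
  have "\<exists>X. W y X" for y
  proof -
    from slf have "\<forall>y. \<exists>X. finite X \<and> (\<forall>x\<in>X. sprec Hom x y) \<and>
        (\<forall>z f. sprec Hom z y \<longrightarrow> f \<in> Hom z y \<longrightarrow>
           (\<exists>(n::nat) xs g h. (\<forall>i<n. xs i \<in> X \<and> g i \<in> Hom z (xs i) \<and> h i \<in> Hom (xs i) y)
                \<and> f = (\<Sum>i<n. cmp z (xs i) y (h i) (g i))))"
      unfolding left_strictly_locally_finite_def by (rule conjunct2)
    from this[rule_format, of y] obtain X where X: "finite X" "\<forall>x\<in>X. sprec Hom x y"
      and gen: "\<forall>z f. sprec Hom z y \<longrightarrow> f \<in> Hom z y \<longrightarrow>
           (\<exists>(n::nat) xs g h. (\<forall>i<n. xs i \<in> X \<and> g i \<in> Hom z (xs i) \<and> h i \<in> Hom (xs i) y)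
                \<and> f = (\<Sum>i<n. cmp z (xs i) y (h i) (g i)))"
      by (elim exE conjE)
    show ?thesis unfolding W_def D_def
      by (intro exI[of _ X] conjI ballI X core_decomp[OF X(1) gen[rule_format]])
  qed
  then have W: "W y (SOME X. W y X)" for y by (rule someI_ex)
  define X where "X y = (SOME X. W y X)" for y
  have X: "finite (X z)" "\<And>x. x \<in> X z \<Longrightarrow> sprec Hom x z" "\<And>v. v \<in> core z \<Longrightarrow> \<exists>u. D z (X z) v u" for z
    using W[of z] unfolding W_def X_def by simp_all
  define G where "G z v u \<longleftrightarrow> (\<forall>x g. x \<notin> X z \<longrightarrow> u x g = 0) \<and> (v \<in> core z \<longrightarrow> D z (X z) v u)" for z v u
  have "\<exists>u. G z v u" for z v
  proof (cases "v \<in> core z")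
    case True
    then show ?thesis using X(3)[OF True] unfolding G_def by (auto simp: D_def)
  next
    case False
    then show ?thesis unfolding G_def by (intro exI[of _ "\<lambda>_ _. 0"]) simp
  qed
  then have G: "G z v (SOME u. G z v u)" for z v by (rule someI_ex)
  show thesis
    by (rule that[of X "\<lambda>z v. SOME u. G z v u"]) (use X(1,2) G in \<open>auto simp: G_def D_def\<close>)
qed

text \<open>Every step of the unfolding is strictly decreasing, so only finitely many steps reach a
  given object, and the infinite sum of all iterated unfoldings solves a recursive equation.\<close>

lemma unfolding_fixpoint:
  assumes sub: "\<And>x. V.subspace (L x)"
    and u: "\<And>z v x g. v \<in> L z \<Longrightarrow> u z v x g \<in> L x"
    and u0: "\<And>z v x g. \<not> sprec Hom x z \<Longrightarrow> u z v x g = 0"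
    and p: "p \<in> L y"
  obtains T where "\<And>x f. T x f \<in> L x"
    "\<And>x f. T x f = u y p x f + (\<Sum>z\<in>{z. R x z \<and> R z y}. \<Sum>g\<in>B x z. \<Sum>h\<in>B z y.
       sV (coord x y f (cmp x z y h g)) (u z (T z h) x g))"
proof -
  \<comment> \<open>The value at \<open>x\<close> needs only the values at objects \<open>z\<close>
    strictly above \<open>x\<close> with \<open>R z y\<close>. Passing from \<open>x\<close> to
    \<open>z\<close> loses at least \<open>x\<close> itself from the finite interval up to
    \<open>y\<close>.\<close>
  define r where "r = {(z, x). sprec Hom x z \<and> R z y}"
  have "r \<subseteq> measure (\<lambda>x. card {w. R x w \<and> R w y})"
  proof clarify
    fix z x assume "(z, x) \<in> r"
    then have zx: "R x z" "\<not> R z x" "R z y" by (auto simp: r_def sprec_def)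
    then have "{w. R z w \<and> R w y} \<subset> {w. R x w \<and> R w y}"
      using reach_refl[of x] reach_trans[of x z] by blast
    then show "(z, x) \<in> measure (\<lambda>x. card {w. R x w \<and> R w y})"
      using fin_interval by (simp add: psubset_card_mono)
  qed
  then have wf: "wf r" using wf_subset wf_measure by blast
  define F where "F T x f = u y p x f + (\<Sum>z\<in>{z. R x z \<and> R z y}. \<Sum>g\<in>B x z. \<Sum>h\<in>B z y.
       sV (coord x y f (cmp x z y h g)) (u z (T z h) x g))" for T x f
  define T where "T = wfrec r F"
  have eq: "T x f = F T x f" for x f
  proof -
    \<comment> \<open>Truncating \<open>T\<close> outside the predecessors of \<open>x\<close>
      changes nothing: a summand with \<open>z\<close> not strictly above \<open>x\<close> is zero,
      whatever vector \<open>u\<close> is applied to.\<close>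
    have "u z (cut T r x z h) x g = u z (T z h) x g" if "R z y" for z h g
      using that u0 by (cases "sprec Hom x z") (auto simp: cut_apply r_def)
    then have "F (cut T r x) x f = F T x f"
      unfolding F_def by (intro arg_cong2[of _ _ _ _ plus] sum.cong refl) auto
    then show ?thesis using wfrec[OF wf, of F x] by (simp add: T_def)
  qed
  have "\<forall>f. T x f \<in> L x" for x
  proof (induction x rule: wf_induct_rule[OF wf])
    case (1 x)
    have "u z (T z h) x g \<in> L x" if "R z y" for z h g
      using that u0 u 1 sub[of x] V.subspace_0 by (cases "sprec Hom x z") (auto simp: r_def)
    then have "F T x f \<in> L x" for f unfolding F_def
      by (intro V.subspace_add V.subspace_sum V.subspace_scale sub) (auto intro: u p)
    then show ?case by (simp add: eq[of x])
  qed
  then show thesis using eq[unfolded F_def] by (intro that[of T]) (blast, assumption)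
qed

end

section \<open>Contramodules\<close>

lemma sum_apply: "(\<Sum>i\<in>I. F i) x = (\<Sum>i\<in>I. F i x)"
  for F :: "'i \<Rightarrow> 'a \<Rightarrow> 'b::ab_group_add"
  by (induction I rule: infinite_finite_induct) auto

lemma vector_space_fscale: "vector_space s \<Longrightarrow> vector_space (fscale s)"
  unfolding vector_space_def by (auto simp: fscale_def fun_eq_iff)

locale contramodule_over = lf_category sM Hom cmp ident + W: vector_space sP
  for sM :: "'k::field \<Rightarrow> 'm::ab_group_add \<Rightarrow> 'm"
    and Hom :: "'o \<Rightarrow> 'o \<Rightarrow> 'm set"
    and cmp :: "'o \<Rightarrow> 'o \<Rightarrow> 'o \<Rightarrow> 'm \<Rightarrow> 'm \<Rightarrow> 'm"
    and ident :: "'o \<Rightarrow> 'm"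
    and sP :: "'k \<Rightarrow> 'p::ab_group_add \<Rightarrow> 'p" +
  fixes Q :: "'p set"
    and \<pi> :: "(('o \<Rightarrow> 'o \<Rightarrow> 'm \<Rightarrow> 'k) \<Rightarrow> 'p) \<Rightarrow> 'p"
  assumes contra: "contramodule sM Hom cmp ident sP Q \<pi>"
begin

lemma sub_Q: "W.subspace Q"
  and pi_lin: "lin_on (fscale sP) sP (homC sM Hom sP Q) Q \<pi>"
  using contra by (auto simp: contramodule_def)

lemma contra_assoc:
  assumes "\<And>c''. c'' \<in> C \<Longrightarrow> lin_on cscale sP C Q (\<lambda>c'. b c' c'')"
    and "\<And>c'. c' \<in> C \<Longrightarrow> lin_on cscale sP C Q (b c')"
  shows "\<pi> (cext C (\<lambda>c''. \<pi> (cext C (\<lambda>c'. b c' c'')))) = \<pi> (cext C (bmu sM Hom cmp sP b))"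
  using contra assms unfolding contramodule_def by blast

lemma zero_Q: "0 \<in> Q"
  using sub_Q W.subspace_0 by auto

lemma lin_sum:
  assumes "\<And>i. i \<in> I \<Longrightarrow> lin_on cscale sP C Q (F i)"
  shows "lin_on cscale sP C Q (\<lambda>c. \<Sum>i\<in>I. F i c)"
  unfolding lin_on_def
  using lin_on_mem[OF assms] lin_on_add[OF assms] lin_on_scale[OF assms]
  by (auto simp: sum.distrib[symmetric] W.scale_sum_right intro!: sum.cong W.subspace_sum[OF sub_Q])

lemma lin_eval: "p \<in> Q \<Longrightarrow> lin_on cscale sP C Q (\<lambda>c. sP (c x y f) p)"
  unfolding lin_on_def using W.subspace_scale[OF sub_Q]
  by (auto simp: cscale_def W.scale_left_distrib)

lemma cext_homC: "lin_on cscale sP C Q F \<Longrightarrow> cext C F \<in> homC sM Hom sP Q"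
  unfolding homC_def lin_on_def using coalg_add coalg_scale by (auto simp: cext_def)

lemma sub_homC: "module.subspace (fscale sP) (homC sM Hom sP Q)"
proof -
  interpret FS: vector_space "fscale sP" by (rule vector_space_fscale) (rule W.vector_space_axioms)
  show ?thesis
    unfolding FS.subspace_def homC_def lin_on_def
    using zero_Q W.subspace_add[OF sub_Q] W.subspace_scale[OF sub_Q]
    by (auto simp: fscale_def algebra_simps)
qed

lemma pi_sum:
  assumes "\<And>i. i \<in> I \<Longrightarrow> lin_on cscale sP C Q (F i)"
  shows "\<pi> (cext C (\<lambda>c. \<Sum>i\<in>I. F i c)) = (\<Sum>i\<in>I. \<pi> (cext C (F i)))"
proof -
  interpret FS: vector_space "fscale sP" by (rule vector_space_fscale) (rule W.vector_space_axioms)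
  have "cext C (\<lambda>c. \<Sum>i\<in>I. F i c) = (\<Sum>i\<in>I. cext C (F i))"
    by (simp add: fun_eq_iff sum_apply cext_def)
  then show ?thesis
    using FS.lin_on_sum[OF pi_lin sub_homC, of I "\<lambda>i. cext C (F i)"] cext_homC assms by auto
qed

lemma pi_add:
  assumes "lin_on cscale sP C Q F" "lin_on cscale sP C Q G"
  shows "\<pi> (cext C (\<lambda>c. F c + G c)) = \<pi> (cext C F) + \<pi> (cext C G)"
proof -
  have "cext C (\<lambda>c. F c + G c) = cext C F + cext C G" by (auto simp: cext_def)
  then show ?thesis using lin_on_add[OF pi_lin] cext_homC assms by auto
qed

lemma pi_scale:
  assumes "lin_on cscale sP C Q F"
  shows "\<pi> (cext C (\<lambda>c. sP a (F c))) = sP a (\<pi> (cext C F))"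
proof -
  have "cext C (\<lambda>c. sP a (F c)) = fscale sP a (cext C F)" by (auto simp: cext_def fscale_def)
  then show ?thesis using lin_on_scale[OF pi_lin] cext_homC assms by auto
qed

lemma theta_obj_sub: "theta_obj sM Hom ident sP Q \<pi> x \<subseteq> Q"
  unfolding theta_obj_def cdot_def
  using lin_on_mem[OF pi_lin] cext_homC lin_eval by auto

section \<open>Infinite linear combinations in a contramodule\<close>

text \<open>For \<open>u\<close> with values in \<open>Q\<close>, this is the linear map with value
  \<open>u x f\<close> at the dual basis element of \<open>f \<in> B x y\<close> and zero on the
  summands whose second object is not \<open>y\<close>. The family \<open>u\<close> may have
  infinite support, as each \<open>c\<close> has finitely many components; applying
  \<open>\<pi>\<close> gives meaning to the infinite sum of all \<open>f\<close> acting on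
  \<open>u x f\<close>.\<close>

definition lcomb :: "'o \<Rightarrow> ('o \<Rightarrow> 'm \<Rightarrow> 'p) \<Rightarrow> ('o \<Rightarrow> 'o \<Rightarrow> 'm \<Rightarrow> 'k) \<Rightarrow> 'p" where
  "lcomb y u c = (\<Sum>x\<in>{x. c x y \<noteq> (\<lambda>_. 0)}. \<Sum>f\<in>B x y. sP (c x y f) (u x f))"

lemma lcomb_eq:
  assumes "finite S" "\<And>x. x \<notin> S \<Longrightarrow> c x y = (\<lambda>_. 0)"
  shows "lcomb y u c = (\<Sum>x\<in>S. \<Sum>f\<in>B x y. sP (c x y f) (u x f))"
  unfolding lcomb_def using assms by (intro sum.mono_neutral_left) auto

lemma lcomb_finite:
  assumes "finite X" "\<And>x f. x \<notin> X \<Longrightarrow> u x f = 0" "c \<in> C"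
  shows "lcomb y u c = (\<Sum>x\<in>X. \<Sum>f\<in>B x y. sP (c x y f) (u x f))"
proof -
  have "lcomb y u c = (\<Sum>x\<in>X \<union> {x. c x y \<noteq> (\<lambda>_. 0)}. \<Sum>f\<in>B x y. sP (c x y f) (u x f))"
    using assms coalg_fin by (intro lcomb_eq) auto
  also have "\<dots> = (\<Sum>x\<in>X. \<Sum>f\<in>B x y. sP (c x y f) (u x f))"
    using assms coalg_fin by (intro sum.mono_neutral_right) auto
  finally show ?thesis .
qed

lemma lcomb_lin:
  assumes "\<And>x f. u x f \<in> Q"
  shows "lin_on cscale sP C Q (lcomb y u)"
  unfolding lin_on_def
proof (intro conjI ballI allI)
  fix c assume c: "c \<in> C"
  show "lcomb y u c \<in> Q"
    unfolding lcomb_def by (intro W.subspace_sum W.subspace_scale sub_Q assms)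
  fix a
  show "lcomb y u (cscale a c) = sP a (lcomb y u c)"
    using lcomb_eq[OF coalg_fin[OF c, of y], of "cscale a c" y u]
    by (simp add: lcomb_def cscale_def W.scale_sum_right)
  fix d assume d: "d \<in> C"
  \<comment> \<open>The supports of \<open>c\<close>, \<open>d\<close> and \<open>c + d\<close> may
    differ, so the three sums are taken over a common finite set.\<close>
  let ?S = "{x. c x y \<noteq> (\<lambda>_. 0)} \<union> {x. d x y \<noteq> (\<lambda>_. 0)}"
  have "finite ?S" using coalg_fin c d by auto
  from lcomb_eq[OF this, of _ y u] show "lcomb y u (c + d) = lcomb y u c + lcomb y u d"
    by (simp add: sum.distrib W.scale_left_distrib fun_eq_iff)
qed

lemma lcomb_dual:
  assumes "f \<in> B x w"
  shows "lcomb y u (dual x w f) = (if w = y then u x f else 0)"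
proof -
  have "lcomb y u (dual x w f) = (\<Sum>x'\<in>{x}. \<Sum>f'\<in>B x' y. sP (dual x w f x' y f') (u x' f'))"
    by (rule lcomb_eq) (auto simp: dual_apply)
  also have "\<dots> = (if w = y then \<Sum>f'\<in>B x y. if f' = f then u x f else 0 else 0)"
    using assms by (auto simp: dual_apply coord_B intro!: sum.cong)
  finally show ?thesis using assms fin_B by (auto split: if_splits)
qed

text \<open>For a family supported over finitely many objects the map is a finite sum of evaluations
  at morphisms \<open>f\<close>, and \<open>\<pi>\<close> turns each of them into the action of
  \<open>f\<close>.\<close>

lemma pi_lcomb:
  assumes "finite X" "\<And>x f. x \<notin> X \<Longrightarrow> u x f = 0" "\<And>x f. u x f \<in> Q"
  shows "\<pi> (cext C (lcomb y u)) = (\<Sum>x\<in>X. \<Sum>f\<in>B x y. theta_act sM Hom sP \<pi> x y f (u x f))"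
proof -
  have "cext C (lcomb y u) = cext C (\<lambda>c. \<Sum>x\<in>X. \<Sum>f\<in>B x y. sP (c x y f) (u x f))"
    using lcomb_finite[OF assms(1,2)] by (auto simp: cext_def)
  then show ?thesis
    by (simp add: pi_sum lin_sum lin_eval assms theta_act_def cdot_def)
qed

lemma lin_scale:
  assumes "lin_on cscale sP C Q F"
  shows "lin_on cscale sP C Q (\<lambda>c. sP a (F c))"
  using assms W.subspace_scale[OF sub_Q]
  by (auto simp: lin_on_def W.scale_right_distrib mult.commute)

lemma lcomb_lin_coeff:
  "(\<And>x f. lin_on cscale sP C Q (F x f)) \<Longrightarrow> lin_on cscale sP C Q (\<lambda>c. lcomb y (\<lambda>x f. F x f c) c'')"
  unfolding lcomb_def by (intro lin_sum lin_scale)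

text \<open>For fixed \<open>c''\<close> only finitely many coefficients occur, so linearity of
  \<open>\<pi>\<close> suffices even when the family \<open>F\<close> is infinite.\<close>

lemma pi_lcomb_coeff:
  "(\<And>x f. lin_on cscale sP C Q (F x f)) \<Longrightarrow>
    \<pi> (cext C (\<lambda>c. lcomb y (\<lambda>x f. F x f c) c'')) = lcomb y (\<lambda>x f. \<pi> (cext C (F x f))) c''"
  unfolding lcomb_def by (simp add: pi_sum lin_sum lin_scale pi_scale)

end

section \<open>Vanishing of the core by contraassociativity\<close>

lemma sum_swap_inner:
  "(\<Sum>f\<in>A. \<Sum>z\<in>I. \<Sum>g\<in>G z. \<Sum>h\<in>H z. F f z g h) = (\<Sum>z\<in>I. \<Sum>g\<in>G z. \<Sum>h\<in>H z. \<Sum>f\<in>A. F f z g h)"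
  for F :: "_ \<Rightarrow> _ \<Rightarrow> _ \<Rightarrow> _ \<Rightarrow> 'a::comm_monoid_add"
proof -
  have "(\<Sum>f\<in>A. \<Sum>z\<in>I. \<Sum>g\<in>G z. \<Sum>h\<in>H z. F f z g h) = (\<Sum>z\<in>I. \<Sum>f\<in>A. \<Sum>g\<in>G z. \<Sum>h\<in>H z. F f z g h)"
    by (rule sum.swap)
  also have "\<dots> = (\<Sum>z\<in>I. \<Sum>g\<in>G z. \<Sum>f\<in>A. \<Sum>h\<in>H z. F f z g h)"
    by (intro sum.cong refl sum.swap)
  also have "\<dots> = (\<Sum>z\<in>I. \<Sum>g\<in>G z. \<Sum>h\<in>H z. \<Sum>f\<in>A. F f z g h)"
    by (intro sum.cong refl sum.swap)
  finally show ?thesis .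
qed

context slf_module
begin

text \<open>Let \<open>T\<close> sum all unfoldings of \<open>p\<close>. Contraassociativity for the
  map \<open>b\<close> below equates \<open>\<pi>\<close> of the combination with coefficients
  \<open>\<theta> x (T x f)\<close> and \<open>\<pi>\<close> of the one with coefficients
  \<open>d x f\<close>. By the recursive equation for \<open>T\<close> they differ by the first
  unfolding, of value \<open>\<theta> y p\<close>. So this is zero, and \<open>\<theta> y\<close> is
  injective.\<close>

lemma core_zero_if_contramodule:
  fixes sP :: "'k \<Rightarrow> 'p::ab_group_add \<Rightarrow> 'p"
  assumes contra: "contramodule sM Hom cmp ident sP Q \<pi>"
    and iso: "module_iso Hom sV P act sP (theta_obj sM Hom ident sP Q \<pi>) (theta_act sM Hom sP \<pi>)"
  shows "core y = {0}"
proof -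
  have "vector_space sP" using contra by (simp add: contramodule_def)
  then interpret K: contramodule_over sM Hom cmp ident sP Q \<pi>
    by (intro contramodule_over.intro lf_category_axioms)
      (simp_all add: contramodule_over_axioms_def contra)
  obtain \<theta> where \<theta>: "\<And>x. lin_on sV sP (P x) (theta_obj sM Hom ident sP Q \<pi> x) (\<theta> x)"
      "\<And>x. bij_betw (\<theta> x) (P x) (theta_obj sM Hom ident sP Q \<pi> x)"
    and \<theta>_act: "\<And>x y f v. f \<in> Hom x y \<Longrightarrow> v \<in> P x \<Longrightarrow>
      \<theta> y (act x y f v) = theta_act sM Hom sP \<pi> x y f (\<theta> x v)"
    using iso unfolding module_iso_def by blast
  have core_P: "v \<in> P x" if "v \<in> core x" for x v using that core_sub_P by auto
  have \<theta>_Q: "\<theta> x v \<in> Q" if "v \<in> core x" for x v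
    using lin_on_mem[OF \<theta>(1) core_P[OF that]] K.theta_obj_sub by auto
  have \<theta>_zero: "\<theta> x 0 = 0" for x
    using lin_on_zero[OF \<theta>(1) zero_P] .
  obtain X u where X: "\<And>z. finite (X z)" "\<And>x z. x \<in> X z \<Longrightarrow> sprec Hom x z"
    and u: "\<And>z v x g. v \<in> core z \<Longrightarrow> u z v x g \<in> core x"
      "\<And>z v x g. x \<notin> X z \<Longrightarrow> u z v x g = 0"
      "\<And>z v. v \<in> core z \<Longrightarrow> (\<Sum>x\<in>X z. \<Sum>g\<in>B x z. act x z g (u z v x g)) = v"
    using core_decomp_choice[OF that] .
  have u0: "u z v x g = 0" if "\<not> sprec Hom x z" for z v x g
    using that u(2) X(2) by blast
  define w where "w z v x g = \<theta> x (u z v x g)" for z v x g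
  have w_Q: "w z v x g \<in> Q" if "v \<in> core z" for z v x g
    unfolding w_def by (intro \<theta>_Q u that)
  \<comment> \<open>A single decomposition step is supported over the finite set \<open>X z\<close>,
    so its value is an honest finite sum that can be computed in \<open>P\<close> and transported by
    \<open>\<theta>\<close>.\<close>
  have pi_w: "\<pi> (cext C (K.lcomb z (w z v))) = \<theta> z v" if v: "v \<in> core z" for z v
  proof -
    have "\<pi> (cext C (K.lcomb z (w z v))) = (\<Sum>x\<in>X z. \<Sum>g\<in>B x z. theta_act sM Hom sP \<pi> x z g (w z v x g))"
      using X(1) v by (intro K.pi_lcomb w_Q) (auto simp: w_def u \<theta>_zero)
    also have "\<dots> = (\<Sum>x\<in>X z. \<Sum>g\<in>B x z. \<theta> z (act x z g (u z v x g)))"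
      by (intro sum.cong refl) (simp add: w_def \<theta>_act B_Hom core_P u v)
    also have "\<dots> = (\<Sum>x\<in>X z. \<theta> z (\<Sum>g\<in>B x z. act x z g (u z v x g)))"
      by (intro sum.cong refl V.lin_on_sum[OF \<theta>(1) sub_P, symmetric] act_mem B_Hom core_P u v)
    also have "\<dots> = \<theta> z (\<Sum>x\<in>X z. \<Sum>g\<in>B x z. act x z g (u z v x g))"
      by (intro V.lin_on_sum[OF \<theta>(1) sub_P, symmetric] V.subspace_sum sub_P act_mem B_Hom core_P u v)
    finally show ?thesis using u(3)[OF v] by simp
  qed
  have "p = 0" if p: "p \<in> core y" for p
  proof -
    obtain T where T: "\<And>x f. T x f \<in> core x"
      "\<And>x f. T x f = u y p x f + (\<Sum>z\<in>{z. R x z \<and> R z y}. \<Sum>g\<in>B x z. \<Sum>h\<in>B z y.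
         sV (coord x y f (cmp x z y h g)) (u z (T z h) x g))"
      using unfolding_fixpoint[of core u p y, OF sub_core u(1) u0 p that] .
    \<comment> \<open>On the dual elements of \<open>g : x \<rightarrow> z\<close> and
      \<open>h : z \<rightarrow> y\<close> the value is \<open>w z (T z h) x g\<close>: the outer
      \<open>c''\<close> selects a term of \<open>T\<close>, the inner \<open>c'\<close> a term in
      the decomposition of that vector.\<close>
    define b where "b c' c'' = K.lcomb y (\<lambda>z h. K.lcomb z (w z (T z h)) c') c''" for c' c''
    \<comment> \<open>The coefficients of \<open>b\<close> after comultiplication, that is, the
      image under \<open>\<theta>\<close> of \<open>T\<close> without its first summand.\<close>
    define d where "d x f = (\<Sum>z\<in>{z. R x z \<and> R z y}. \<Sum>g\<in>B x z. \<Sum>h\<in>B z y.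
         sP (coord x y f (cmp x z y h g)) (w z (T z h) x g))" for x f
    have \<theta>_T: "\<theta> x (T x f) = w y p x f + d x f" for x f
    proof -
      have sum_P: "(\<Sum>z\<in>I. \<Sum>g\<in>G z. \<Sum>h\<in>H z. sV (a z g h) (u z (T z h) x g)) \<in> P x"
        for I :: "'o set" and G H :: "'o \<Rightarrow> 'm set" and a
        by (intro V.subspace_sum V.subspace_scale sub_P core_P u T)
      have "\<theta> x (T x f) = w y p x f + \<theta> x (\<Sum>z\<in>{z. R x z \<and> R z y}. \<Sum>g\<in>B x z. \<Sum>h\<in>B z y.
         sV (coord x y f (cmp x z y h g)) (u z (T z h) x g))"
        unfolding w_def by (subst T(2), rule lin_on_add[OF \<theta>(1)]) (intro sum_P core_P u p)+
      also have "\<theta> x (\<Sum>z\<in>{z. R x z \<and> R z y}. \<Sum>g\<in>B x z. \<Sum>h\<in>B z y.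
         sV (coord x y f (cmp x z y h g)) (u z (T z h) x g)) = d x f"
        unfolding d_def w_def
        by (simp add: V.lin_on_sum[OF \<theta>(1) sub_P] lin_on_scale[OF \<theta>(1)] V.subspace_sum[OF sub_P]
            V.subspace_scale[OF sub_P] core_P u T(1))
      finally show ?thesis .
    qed
    have d_Q: "d x f \<in> Q" for x f
      unfolding d_def by (intro K.W.subspace_sum K.W.subspace_scale K.sub_Q w_Q T)
    have bmu_b: "bmu sM Hom cmp sP b c = K.lcomb y d c" if c: "c \<in> C" for c
    proof -
      define G where "G x w' = (\<Sum>z\<in>{z. R x z \<and> R z w'}. \<Sum>g\<in>B x z. \<Sum>h\<in>B z w'.
        sP (c x w' (cmp x z w' h g)) (b (dual x z g) (dual z w' h)))" for x w'
      have b_dual: "b (dual x z g) (dual z w' h) = (if w' = y then w z (T z h) x g else 0)"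
        if "g \<in> B x z" "h \<in> B z w'" for x z w' g h
        unfolding b_def using that by (simp add: K.lcomb_dual)
      have G0: "G x w' = 0" if "w' \<noteq> y" for x w'
        unfolding G_def using that by (simp add: b_dual)
      \<comment> \<open>The sum over \<open>f\<close> expands the composite of \<open>g\<close> and
        \<open>h\<close> in \<open>B x y\<close>; linearity of \<open>c x y\<close> reassembles the
        value at that composite.\<close>
      have Gy: "G x y = (\<Sum>f\<in>B x y. sP (c x y f) (d x f))" for x
      proof -
        have "(\<Sum>f\<in>B x y. sP (c x y f) (d x f)) =
          (\<Sum>f\<in>B x y. \<Sum>z\<in>{z. R x z \<and> R z y}. \<Sum>g\<in>B x z. \<Sum>h\<in>B z y.
            sP (coord x y f (cmp x z y h g) * c x y f) (w z (T z h) x g))"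
          by (simp add: d_def K.W.scale_sum_right mult.commute)
        also have "\<dots> = (\<Sum>z\<in>{z. R x z \<and> R z y}. \<Sum>g\<in>B x z. \<Sum>h\<in>B z y.
            sP (\<Sum>f\<in>B x y. coord x y f (cmp x z y h g) * c x y f) (w z (T z h) x g))"
          by (simp add: sum_swap_inner K.W.scale_sum_left)
        also have "\<dots> = G x y"
          unfolding G_def
          by (intro sum.cong refl) (simp add: b_dual lin_expand[OF coalg_lin[OF c]] cmp_Hom B_Hom)
        finally show ?thesis by simp
      qed
      let ?S = "{(x, w'). c x w' \<noteq> (\<lambda>_. 0)}"
      have fin: "finite ?S" using c by (simp add: coalg_def)
      have "bmu sM Hom cmp sP b c = (\<Sum>(x, w')\<in>?S. G x w')"
        unfolding bmu_def G_def by simp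
      also have "\<dots> = (\<Sum>(x, w')\<in>(\<lambda>x. (x, y)) ` {x. c x y \<noteq> (\<lambda>_. 0)}. G x w')"
        using fin by (intro sum.mono_neutral_right) (auto intro: G0)
      also have "\<dots> = (\<Sum>x\<in>{x. c x y \<noteq> (\<lambda>_. 0)}. G x y)"
        by (subst sum.reindex) (auto simp: inj_on_def)
      finally show ?thesis by (simp add: Gy K.lcomb_def)
    qed
    have lin_w: "lin_on cscale sP C Q (K.lcomb z (w z (T z h)))" for z h
      by (intro K.lcomb_lin w_Q T)
    have "\<pi> (cext C (\<lambda>c''. \<pi> (cext C (\<lambda>c'. b c' c'')))) = \<pi> (cext C (bmu sM Hom cmp sP b))"
    proof (rule K.contra_assoc)
      show "lin_on cscale sP C Q (\<lambda>c'. b c' c'')" for c''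
        unfolding b_def by (rule K.lcomb_lin_coeff[OF lin_w])
      show "lin_on cscale sP C Q (b c')" if "c' \<in> C" for c'
        unfolding b_def by (intro K.lcomb_lin lin_on_mem[OF lin_w] that)
    qed
    \<comment> \<open>The inner \<open>\<pi>\<close> undoes one decomposition step: by
      \<open>pi_w\<close> it turns the unfolding of \<open>T z h\<close> back into
      \<open>\<theta> z (T z h)\<close>.\<close>
    moreover have "\<pi> (cext C (\<lambda>c'. b c' c'')) = K.lcomb y (\<lambda>z h. \<theta> z (T z h)) c''" for c''
      unfolding b_def by (simp add: K.pi_lcomb_coeff lin_w pi_w T(1))
    moreover have "cext C (bmu sM Hom cmp sP b) = cext C (K.lcomb y d)"
      by (auto simp: cext_def bmu_b)
    moreover have "K.lcomb y (\<lambda>z h. \<theta> z (T z h)) c = K.lcomb y (w y p) c + K.lcomb y d c" for c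
      unfolding K.lcomb_def by (simp add: \<theta>_T K.W.scale_right_distrib sum.distrib)
    ultimately have "\<pi> (cext C (\<lambda>c. K.lcomb y (w y p) c + K.lcomb y d c)) = \<pi> (cext C (K.lcomb y d))"
      by simp
    then have "\<theta> y p = 0"
      using K.pi_add[OF K.lcomb_lin K.lcomb_lin, of "w y p" d y y] w_Q p d_Q pi_w[OF p] by simp
    then show "p = 0"
      using \<theta>(2)[of y] \<theta>_zero[of y] core_P[OF p] zero_P unfolding bij_betw_def inj_on_def by metis
  qed
  then show ?thesis using V.subspace_0[OF sub_core] by blast
qed

section \<open>The contramodule structure on the product\<close>

text \<open>The product of all \<open>P x\<close> is realised by functions on objects. As every
  component of \<open>\<pi>\<close> is a finite sum, contraassociativity reduces to associativity of
  the action and a reordering of finite sums.\<close>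

lemma contramodule_if_finite:
  assumes fin: "\<And>y. finite {x. \<exists>f\<in>Hom x y. \<exists>v\<in>P x. act x y f v \<noteq> 0}"
  shows "\<exists>(Q :: ('o \<Rightarrow> 'v) set) \<pi>. contramodule sM Hom cmp ident (pscale sV) Q \<pi>
    \<and> locally_finite_module (pscale sV) (theta_obj sM Hom ident (pscale sV) Q \<pi>)
    \<and> module_iso Hom sV P act (pscale sV) (theta_obj sM Hom ident (pscale sV) Q \<pi>)
         (theta_act sM Hom (pscale sV) \<pi>)"
proof -
  define S where "S y = {x. \<exists>f\<in>Hom x y. \<exists>v\<in>P x. act x y f v \<noteq> 0}" for y
  define Q where "Q = {p. \<forall>x. p x \<in> P x}"
  define \<pi> where "\<pi> F y = (\<Sum>x\<in>S y. \<Sum>g\<in>B x y. act x y g (F (dual x y g) x))"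
    for F :: "('o \<Rightarrow> 'o \<Rightarrow> 'm \<Rightarrow> 'k) \<Rightarrow> 'o \<Rightarrow> 'v" and y
  have fin_S: "finite (S y)" for y using fin by (simp add: S_def)
  have act_S: "act x y f v = 0" if "x \<notin> S y" "f \<in> Hom x y" "v \<in> P x" for x y f v
    using that by (auto simp: S_def)
  interpret PS: vector_space "pscale sV"
    by unfold_locales
      (auto simp: pscale_def fun_eq_iff V.scale_right_distrib V.scale_left_distrib)
  have sub_Q: "PS.subspace Q"
    unfolding PS.subspace_def Q_def using zero_P V.subspace_add[OF sub_P] V.subspace_scale[OF sub_P]
    by (auto simp: pscale_def)
  have Q_P: "p x \<in> P x" if "p \<in> Q" for p x using that by (simp add: Q_def)
  have pi_cext: "\<pi> (cext C F) y = (\<Sum>x\<in>S y. \<Sum>g\<in>B x y. act x y g (F (dual x y g) x))" for F y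
    by (simp add: \<pi>_def cext_def dual_coalg)
  have homC_P: "F (dual x y g) z \<in> P z" if "F \<in> homC sM Hom (pscale sV) Q" for F x y g z
  proof -
    have "lin_on cscale (pscale sV) C Q F" using that by (simp add: homC_def)
    from lin_on_mem[OF this dual_coalg] show ?thesis by (rule Q_P)
  qed
  have pi_Q: "\<pi> F \<in> Q" if "F \<in> homC sM Hom (pscale sV) Q" for F
    unfolding Q_def \<pi>_def using homC_P[OF that]
    by (auto intro!: V.subspace_sum[OF sub_P] act_mem B_Hom)
  have pi_lin: "lin_on (fscale (pscale sV)) (pscale sV) (homC sM Hom (pscale sV) Q) Q \<pi>"
    unfolding lin_on_def
  proof (intro conjI ballI allI ext)
    fix F y assume F: "F \<in> homC sM Hom (pscale sV) Q"
    show "\<pi> F \<in> Q" by (rule pi_Q[OF F])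
    fix a
    show "\<pi> (fscale (pscale sV) a F) y = pscale sV a (\<pi> F) y"
      by (simp add: \<pi>_def fscale_def pscale_def V.scale_sum_right lin_on_scale[OF act_lin] B_Hom
          homC_P[OF F])
    fix G assume G: "G \<in> homC sM Hom (pscale sV) Q"
    show "\<pi> (F + G) y = (\<pi> F + \<pi> G) y"
      by (simp add: \<pi>_def sum.distrib[symmetric] lin_on_add[OF act_lin] B_Hom
          homC_P[OF F] homC_P[OF G])
  qed
  \<comment> \<open>If \<open>x\<close> is not in \<open>S y\<close>, all terms on the left are
    zero, and so is the right side by the definition of \<open>S y\<close>.\<close>
  have single_sum: "(\<Sum>x'\<in>S y. if x' = x then act x y f v else 0) = act x y f v"
    if "f \<in> Hom x y" "v \<in> P x" for x y f v
    using act_S[OF _ that] fin_S by (auto simp: sum.delta)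
  have basis_sum: "(\<Sum>g\<in>B x y. act x y g (sV (coord x y g f) v)) = act x y f v"
    if "f \<in> Hom x y" "v \<in> P x" for x y f v
    using lin_expand[OF act_lin_left[OF that(2)] that(1)]
    by (simp add: lin_on_scale[OF act_lin] B_Hom that)
  have counit: "\<pi> (cext C (\<lambda>c. pscale sV (counit ident c) p)) = p" if p: "p \<in> Q" for p
  proof
    fix y
    have "\<pi> (cext C (\<lambda>c. pscale sV (counit ident c) p)) y =
      (\<Sum>x\<in>S y. \<Sum>g\<in>B x y. act x y g (sV (counit ident (dual x y g)) (p x)))"
      by (simp add: pi_cext pscale_def)
    also have "\<dots> = (\<Sum>x\<in>S y. if x = y then act y y (ident y) (p y) else 0)"
      using basis_sum[OF ident_Hom Q_P[OF p]]
      by (intro sum.cong refl) (auto simp: counit_dual act_zero B_Hom)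
    finally show "\<pi> (cext C (\<lambda>c. pscale sV (counit ident c) p)) y = p y"
      using single_sum[OF ident_Hom Q_P[OF p]] act_ident[OF Q_P[OF p]] by simp
  qed
  \<comment> \<open>Evaluation at \<open>f\<close> applies \<open>f\<close> to component
    \<open>x\<close> and places the result in component \<open>w\<close>. For
    \<open>f = ident x\<close> this is the projection onto the factor \<open>P x\<close>, which
    identifies the spaces \<open>theta_obj\<close>.\<close>
  have cdot: "cdot sM Hom (pscale sV) \<pi> (\<lambda>c. c x w f) p = (\<lambda>y. if y = w then act x w f (p x) else 0)"
    if f: "f \<in> Hom x w" and p: "p \<in> Q" for x w f p
  proof
    fix y
    have "cdot sM Hom (pscale sV) \<pi> (\<lambda>c. c x w f) p y =
      (\<Sum>x'\<in>S y. \<Sum>g\<in>B x' y. act x' y g (sV (dual x' y g x w f) (p x')))"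
      by (simp add: cdot_def pi_cext pscale_def)
    also have "\<dots> = (if y = w then \<Sum>x'\<in>S w. if x' = x then act x w f (p x) else 0 else 0)"
      using basis_sum[OF f Q_P[OF p]]
      by (auto simp: dual_apply act_zero B_Hom intro!: sum.cong sum.neutral)
    finally show "cdot sM Hom (pscale sV) \<pi> (\<lambda>c. c x w f) p y = (if y = w then act x w f (p x) else 0)"
      using single_sum[OF f Q_P[OF p]] by simp
  qed
  have assoc: "\<pi> (cext C (\<lambda>c''. \<pi> (cext C (\<lambda>c'. b c' c''))))
      = \<pi> (cext C (bmu sM Hom cmp (pscale sV) b))"
    if b: "\<And>c''. c'' \<in> C \<Longrightarrow> lin_on cscale (pscale sV) C Q (\<lambda>c'. b c' c'')" for b
  proof
    fix y
    define \<beta> where "\<beta> x z g h = b (dual x z g) (dual z y h) x" for x z g h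
    have \<beta>: "\<beta> x z g h \<in> P x" for x z g h
      unfolding \<beta>_def by (intro Q_P lin_on_mem[OF b] dual_coalg)
    \<comment> \<open>The contribution of all paths from \<open>x\<close> through \<open>z\<close>
      to \<open>y\<close>. The iterated \<open>\<pi>\<close> yields it as an iterated action, the
      comultiplication as the action of composites, as in \<open>K_alt\<close>.\<close>
    define K where "K x z = (\<Sum>g\<in>B x z. \<Sum>h\<in>B z y. act z y h (act x z g (\<beta> x z g h)))" for x z
    have K_alt: "K x z = (\<Sum>g\<in>B x z. \<Sum>h\<in>B z y. act x y (cmp x z y h g) (\<beta> x z g h))" for x z
      unfolding K_def by (intro sum.cong refl act_cmp[symmetric] B_Hom \<beta>)
    \<comment> \<open>The index sets differ: \<open>z \<in> S y\<close> and
      \<open>x \<in> S z\<close> on one side, \<open>x \<in> S y\<close> and \<open>z\<close> in an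
      interval on the other. Since the extra terms vanish, both sums can be taken over
      \<open>x\<close> and \<open>z\<close> in \<open>S y\<close>.\<close>
    have K0: "K x z = 0" if out: "x \<notin> S y \<or> x \<notin> S z \<or> z \<notin> S y \<or> \<not> (R x z \<and> R z y)" for x z
    proof -
      consider "x \<notin> S y" | "x \<notin> S z" | "z \<notin> S y" | "\<not> (R x z \<and> R z y)" using out by blast
      then show ?thesis
      proof cases
        case 1
        then show ?thesis unfolding K_alt by (simp add: act_S cmp_Hom B_Hom \<beta>)
      next
        case 2
        then show ?thesis unfolding K_def by (simp add: act_S act_zero B_Hom \<beta>)
      next
        case 3
        then show ?thesis unfolding K_def
          by (intro sum.neutral ballI act_S act_mem) (auto intro: B_Hom \<beta>)
      next
        case 4
        then have "B x z = {} \<or> B z y = {}" using reach_B by blast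
        then show ?thesis unfolding K_def by auto
      qed
    qed
    have "\<pi> (cext C (\<lambda>c''. \<pi> (cext C (\<lambda>c'. b c' c'')))) y =
      (\<Sum>z\<in>S y. \<Sum>h\<in>B z y. act z y h (\<Sum>x\<in>S z. \<Sum>g\<in>B x z. act x z g (\<beta> x z g h)))"
      by (simp add: pi_cext \<beta>_def)
    also have "\<dots> = (\<Sum>z\<in>S y. \<Sum>h\<in>B z y. \<Sum>x\<in>S z. \<Sum>g\<in>B x z. act z y h (act x z g (\<beta> x z g h)))"
      by (simp add: V.lin_on_sum[OF act_lin sub_P] B_Hom act_mem \<beta> V.subspace_sum[OF sub_P])
    also have "\<dots> = (\<Sum>z\<in>S y. \<Sum>x\<in>S z. K x z)"
      unfolding K_def
      by (intro sum.cong refl) (subst sum.swap, intro sum.cong refl sum.swap)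
    also have "\<dots> = (\<Sum>z\<in>S y. \<Sum>x\<in>S y. K x z)"
      by (intro sum.cong refl sum.mono_neutral_cong) (auto simp: fin_S K0)
    finally have left: "\<pi> (cext C (\<lambda>c''. \<pi> (cext C (\<lambda>c'. b c' c'')))) y = (\<Sum>x\<in>S y. \<Sum>z\<in>S y. K x z)"
      by (subst sum.swap) simp
    have "\<pi> (cext C (bmu sM Hom cmp (pscale sV) b)) y =
      (\<Sum>x\<in>S y. \<Sum>f\<in>B x y. act x y f (\<Sum>z\<in>{z. R x z \<and> R z y}. \<Sum>g\<in>B x z. \<Sum>h\<in>B z y.
         sV (coord x y f (cmp x z y h g)) (\<beta> x z g h)))"
      by (simp add: pi_cext bmu_dual sum_apply \<beta>_def pscale_def)
    also have "\<dots> = (\<Sum>x\<in>S y. \<Sum>f\<in>B x y. \<Sum>z\<in>{z. R x z \<and> R z y}. \<Sum>g\<in>B x z. \<Sum>h\<in>B z y.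
         act x y f (sV (coord x y f (cmp x z y h g)) (\<beta> x z g h)))"
      by (simp add: V.lin_on_sum[OF act_lin sub_P] B_Hom \<beta> V.subspace_sum[OF sub_P]
          V.subspace_scale[OF sub_P])
    also have "\<dots> = (\<Sum>x\<in>S y. \<Sum>z\<in>{z. R x z \<and> R z y}. K x z)"
      unfolding K_alt sum_swap_inner by (intro sum.cong refl basis_sum cmp_Hom B_Hom \<beta>)
    also have "\<dots> = (\<Sum>x\<in>S y. \<Sum>z\<in>S y. K x z)"
      by (intro sum.cong refl sum.mono_neutral_cong) (auto simp: fin_S fin_interval K0)
    finally show "\<pi> (cext C (\<lambda>c''. \<pi> (cext C (\<lambda>c'. b c' c'')))) y
      = \<pi> (cext C (bmu sM Hom cmp (pscale sV) b)) y" using left by simp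
  qed
  have contra: "contramodule sM Hom cmp ident (pscale sV) Q \<pi>"
    unfolding contramodule_def
    using PS.vector_space_axioms sub_Q pi_lin counit assoc by auto
  \<comment> \<open>The inclusion of \<open>P x\<close> as one factor of the product; these maps
    form the module isomorphism.\<close>
  define \<delta> where "\<delta> x v = (\<lambda>y. if y = x then v else 0)" for x :: 'o and v :: 'v
  have \<delta>_Q: "\<delta> x v \<in> Q" if "v \<in> P x" for x v
    using that zero_P by (simp add: \<delta>_def Q_def)
  have obj: "theta_obj sM Hom ident (pscale sV) Q \<pi> x = \<delta> x ` P x" for x
  proof -
    have "theta_obj sM Hom ident (pscale sV) Q \<pi> x = (\<lambda>p. \<delta> x (p x)) ` Q"
      unfolding theta_obj_def
      by (intro image_cong refl) (simp add: cdot ident_Hom \<delta>_def act_ident Q_P cong: if_cong)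
    also have "\<dots> = \<delta> x ` P x"
    proof (intro equalityI image_subsetI)
      fix v assume "v \<in> P x"
      from \<delta>_Q[OF this] show "\<delta> x v \<in> (\<lambda>p. \<delta> x (p x)) ` Q"
        by (rule rev_image_eqI) (simp add: \<delta>_def)
    qed (simp add: Q_P)
    finally show ?thesis .
  qed
  have \<delta>_hom: "module_hom sV (pscale sV) (\<delta> x)" for x
    by unfold_locales (auto simp: \<delta>_def pscale_def fun_eq_iff)
  have \<delta>_lin: "lin_on sV (pscale sV) (P x) (\<delta> x ` P x) (\<delta> x)" for x
    by (auto simp: lin_on_def module_hom.add[OF \<delta>_hom] module_hom.scale[OF \<delta>_hom])
  have "locally_finite_module (pscale sV) (\<lambda>x. \<delta> x ` P x)"
    unfolding locally_finite_module_def
  proof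
    fix x
    show "fin_dim (pscale sV) (\<delta> x ` P x)"
      using fin_dim_image[OF V.module_axioms PS.module_axioms \<delta>_lin refl sub_P]
        module_hom.subspace_image[OF \<delta>_hom sub_P] fin_mod
      by (auto simp: locally_finite_module_def)
  qed
  moreover have "module_iso Hom sV P act (pscale sV) (\<lambda>x. \<delta> x ` P x) (theta_act sM Hom (pscale sV) \<pi>)"
    unfolding module_iso_def
  proof (intro exI[of _ \<delta>] conjI allI ballI \<delta>_lin)
    show "bij_betw (\<delta> x) (P x) (\<delta> x ` P x)" for x
      by (rule bij_betwI'[OF _ _ imageE]) (auto simp: \<delta>_def fun_eq_iff)
    show "\<delta> y (act x y f v) = theta_act sM Hom (pscale sV) \<pi> x y f (\<delta> x v)"
      if "f \<in> Hom x y" "v \<in> P x" for x y f v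
      unfolding theta_act_def using cdot[OF that(1) \<delta>_Q[OF that(2)]] by (simp add: \<delta>_def cong: if_cong)
  qed
  ultimately show ?thesis using contra obj by (intro exI[of _ Q] exI[of _ \<pi>]) (simp add: obj[abs_def])
qed

end

text \<open>An existential cannot range over types, so the equivalence seeks the contramodule inside
  \<open>'o \<Rightarrow> 'v\<close>, where the product of the \<open>P x\<close> lives. The second
  conjunct states necessity for contramodules in an arbitrary type \<open>'p\<close>; it and the
  converse in the equivalence both follow from the vanishing of the core.\<close>

theorem theorem4p2:
  fixes sM :: "'k::field \<Rightarrow> 'm::ab_group_add \<Rightarrow> 'm"
    and Hom :: "'o \<Rightarrow> 'o \<Rightarrow> 'm set"
    and cmp :: "'o \<Rightarrow> 'o \<Rightarrow> 'o \<Rightarrow> 'm \<Rightarrow> 'm \<Rightarrow> 'm"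
    and ident :: "'o \<Rightarrow> 'm"
    and sV :: "'k \<Rightarrow> 'v::ab_group_add \<Rightarrow> 'v"
    and P :: "'o \<Rightarrow> 'v set"
    and act :: "'o \<Rightarrow> 'o \<Rightarrow> 'm \<Rightarrow> 'v \<Rightarrow> 'v"
  assumes E: "k_linear_category sM Hom cmp ident"
    and slf: "left_strictly_locally_finite sM Hom cmp"
    and Pmod: "left_module sM Hom cmp ident sV P act"
    and Plf: "locally_finite_module sV P"
  shows "((\<forall>y. finite {x. \<exists>f\<in>Hom x y. \<exists>v\<in>P x. act x y f v \<noteq> 0}) \<longleftrightarrow>
           (\<exists>(Q :: ('o \<Rightarrow> 'v) set) \<pi>.
               contramodule sM Hom cmp ident (pscale sV) Q \<pi>
             \<and> locally_finite_module (pscale sV) (theta_obj sM Hom ident (pscale sV) Q \<pi>)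
             \<and> module_iso Hom sV P act (pscale sV) (theta_obj sM Hom ident (pscale sV) Q \<pi>)
                  (theta_act sM Hom (pscale sV) \<pi>)))
         \<and> (\<forall>(sP :: 'k \<Rightarrow> 'p::ab_group_add \<Rightarrow> 'p) Q \<pi>.
              contramodule sM Hom cmp ident sP Q \<pi> \<and>
              module_iso Hom sV P act sP (theta_obj sM Hom ident sP Q \<pi>) (theta_act sM Hom sP \<pi>) \<longrightarrow>
              (\<forall>y. finite {x. \<exists>f\<in>Hom x y. \<exists>v\<in>P x. act x y f v \<noteq> 0}))"
proof -
  have E': "vector_space sM" using E by (simp add: k_linear_category_def)
  have V': "vector_space sV" using Pmod by (simp add: left_module_def)
  interpret slf_module sM Hom cmp ident sV P act
    unfolding slf_module_def lf_category_def lf_category_axioms_def slf_module_axioms_def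
    using E' V' E slf Pmod Plf by (simp add: left_strictly_locally_finite_def)
  show ?thesis
  proof (intro conjI iffI allI impI)
    assume "\<forall>y. finite {x. \<exists>f\<in>Hom x y. \<exists>v\<in>P x. act x y f v \<noteq> 0}"
    then show "\<exists>(Q :: ('o \<Rightarrow> 'v) set) \<pi>.
               contramodule sM Hom cmp ident (pscale sV) Q \<pi>
             \<and> locally_finite_module (pscale sV) (theta_obj sM Hom ident (pscale sV) Q \<pi>)
             \<and> module_iso Hom sV P act (pscale sV) (theta_obj sM Hom ident (pscale sV) Q \<pi>)
                  (theta_act sM Hom (pscale sV) \<pi>)"
      by (intro contramodule_if_finite) blast
  qed (elim exE conjE, rule core_eq_zero, erule (1) core_zero_if_contramodule)+
qed

end
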